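(* Let $k\in\{1,2,3,\ldots\}$ and let $\varphi_k:\mathbb{T}^2\to\mathbb{S}^2\subset\mathbb{R}^3$ be the proper biharmonic map $$\varphi_k(\gamma,\vartheta)=\left(\sin(\alpha^* )\cos(k\gamma),\ \sin(\alpha^* )\sin(k\gamma),\ \cos(\alpha^* )\right),\qquad \alpha^*=\frac{\pi}{4}.$$ Then the eigenvalues of the second variation operator $I_2$ associated to $\varphi_k$ are parametrized by $(m,n)\in\mathbb{N}\times\mathbb{N}$ ($\mathbb{N}=\{0,1,2,\ldots\}$) as follows. If $m=n=0$: $\mu_0=0$ and $\mu_1=-k^4$. If $m\ge 1$, $n=0$: $$\lambda_{m,0}^{\pm}=\tfrac12\left(-k^4+5k^2m^2+2m^4\pm\sqrt{k^8+2k^6m^2+k^4m^4+32k^2m^6}\right).$$ If $m=0$, $n\ge 1$: $$\lambda_{0,n}^{+}=n^2(n^2+k^2),\qquad \lambda_{0,n}^{-}=n^4-k^4.$$ If $m,n\ge 1$: $$\lambda_{m,n}^{\pm}=\tfrac12\Big(-k^4+k^2(5m^2+n^2)+2(m^2+n^2)^2\pm\sqrt{k^8+2k^6(m^2+n^2)+k^4(m^2+n^2)^2+32k^2m^2(m^2+n^2)^2}\Big).$$ Moreover, the multiplicities $\nu$ of these eigenvalues are $$\nu(\mu_0)=\nu(\mu_1)=1,\quad \nu(\lambda_{m,0}^{\pm})=2,\quad \nu(\lambda_{0,n}^{\pm})=2,\quad \nu(\lambda_{m,n}^{\pm})=4\ (m,n\ge1),$$ where, if the same real number occurs for several entries of this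 list, its total multiplicity as an eigenvalue of $I_2$ is the sum of the listed multiplicities of those entries.
   Context: $\mathbb{T}^2=(\mathbb{S}^1\times\mathbb{S}^1,\ d\gamma^2+d\vartheta^2)$, $0\le\gamma,\vartheta\le 2\pi$, is the flat torus (both circles of length $2\pi$), and $\mathbb{S}^2$ is the unit sphere. For a smooth map $\varphi:M\to N$ of Riemannian manifolds, $M$ compact, the tension field is $\tau(\varphi)=\mathrm{trace}\,\nabla d\varphi$, and the bienergy is $E_2(\varphi)=\frac12\int_M|\tau(\varphi)|^2\,dv_M$. Biharmonic maps are the critical points of $E_2$; a biharmonic map is proper if it is not harmonic, i.e. $\tau(\varphi)\not\equiv0$. For a biharmonic map $\varphi$ and a two-parameter smooth variation $\varphi_{t,s}$ with $\varphi_{0,0}=\varphi$, $V=\frac{d}{dt}|_{t=0}\varphi_{t,0}$, $W=\frac{d}{ds}|_{s=0}\varphi_{0,s}$, the Hessian is $H(E_2)_\varphi(V,W)=\frac{\partial^2}{\partial t\partial s}|_{(0,0)}E_2(\varphi_{t,s})=\int_M\langle I_2(V),W\rangle\,dv_M$, where the second variation operator $I_2$ acts on the space $\mathcal{C}(\varphi^{-1}TN)$ of smooth sections of the pull-back bundle $\varphi^{-1}TN$. When $N=\mathbb{S}^n$ is the unit sphere, with $\{e_i\}$ a local orthonormal frame of $M$, $\nabla^\varphi$ the induced connection on $\varphi^{-1}TN$ and $\overline{\Delta}=-\sum_i(\nabla^\varphi_{e_i}\nabla^\varphi_{e_i}-\nabla^\varphi_{\nabla^M_{e_i}e_i})$,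 it is $$\begin{aligned}I_2(V)=\ &\overline{\Delta}^2V+\overline{\Delta}\big(T(V)-|d\varphi|^2V\big)+2\langle d\tau(\varphi),d\varphi\rangle V+|\tau(\varphi)|^2V-2\sum_i\langle V,\nabla^\varphi_{e_i}\tau(\varphi)\rangle d\varphi(e_i)\\&-2\sum_i\langle\tau(\varphi),\nabla^\varphi_{e_i}V\rangle d\varphi(e_i)-\langle\tau(\varphi),V\rangle\tau(\varphi)+T(\overline{\Delta}V)+T(T(V))-2|d\varphi|^2T(V)\\&+2\langle dV,d\varphi\rangle\tau(\varphi)-|d\varphi|^2\overline{\Delta}V+|d\varphi|^4V,\end{aligned}$$ where $T(V)=\sum_i\langle V,d\varphi(e_i)\rangle d\varphi(e_i)$, $\langle d\tau(\varphi),d\varphi\rangle=\sum_i\langle\nabla^\varphi_{e_i}\tau(\varphi),d\varphi(e_i)\rangle$ and $\langle dV,d\varphi\rangle=\sum_i\langle\nabla^\varphi_{e_i}V,d\varphi(e_i)\rangle$. The multiplicity of an eigenvalue is the dimension of its eigenspace in $\mathcal{C}(\varphi^{-1}TN)$. *)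

theory Defs
  imports "HOL-Analysis.Analysis" "HOL-Library.Function_Algebras"
begin

text \<open>
  Functions on the flat torus are functions of \<open>(\<gamma>, \<theta>) \<in> \<real>\<^sup>2\<close> that are \<open>2\<pi>\<close>-periodic in each
  variable.  The two elements of \<^term>\<open>Basis :: (real \<times> real) set\<close> are the coordinate fields
  \<open>\<partial>/\<partial>\<gamma>\<close> and \<open>\<partial>/\<partial>\<theta>\<close>; they form a global orthonormal frame that is parallel, so the terms
  \<open>\<nabla>\<^sup>M\<^bsub>e\<^esub> e\<close> in the trace formulas vanish and are not written.
\<close>

type_synonym pt = "real \<times> real"

definition torus_periodic :: "(pt \<Rightarrow> 'a) \<Rightarrow> bool" where
  "torus_periodic f \<longleftrightarrow> (\<forall>x y. f (x + 2 * pi, y) = f (x, y) \<and> f (x, y + 2 * pi) = f (x, y))"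

definition dir_deriv ::
    "'b::real_normed_vector \<Rightarrow> ('b \<Rightarrow> 'a::real_normed_vector) \<Rightarrow> 'b \<Rightarrow> 'a" where
  "dir_deriv v f p = frechet_derivative f (at p) v"

text \<open>\<open>C\<^sup>k\<close> and \<open>C\<^sup>\<infinity>\<close>; intended for open \<open>S\<close> in a finite-dimensional space.\<close>

primrec Ck_on ::
    "nat \<Rightarrow> 'b::real_normed_vector set \<Rightarrow> ('b \<Rightarrow> 'a::real_normed_vector) \<Rightarrow> bool" where
  "Ck_on 0 S f \<longleftrightarrow> continuous_on S f"
| "Ck_on (Suc k) S f \<longleftrightarrow>
     (\<forall>p\<in>S. f differentiable (at p)) \<and> (\<forall>v. Ck_on k S (dir_deriv v f))"

definition smooth_on ::
    "'b::real_normed_vector set \<Rightarrow> ('b \<Rightarrow> 'a::real_normed_vector) \<Rightarrow> bool" where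
  "smooth_on S f \<longleftrightarrow> (\<forall>k. Ck_on k S f)"

definition torus_sphere_map :: "(pt \<Rightarrow> 'a::euclidean_space) \<Rightarrow> bool" where
  "torus_sphere_map \<phi> \<longleftrightarrow> smooth_on UNIV \<phi> \<and> torus_periodic \<phi> \<and> range \<phi> \<subseteq> sphere 0 1"

text \<open>Smooth sections of \<open>\<phi>\<^sup>-\<^sup>1 T\<S>\<close>: the tangent space of the unit sphere at \<open>y\<close> is \<open>y\<^sup>\<bottom>\<close>.\<close>

definition sections :: "(pt \<Rightarrow> 'a::euclidean_space) \<Rightarrow> (pt \<Rightarrow> 'a) set" where
  "sections \<phi> = {V. smooth_on UNIV V \<and> torus_periodic V \<and> (\<forall>p. V p \<bullet> \<phi> p = 0)}"

text \<open>
  The Levi-Civita connection of the sphere is the tangential part of the flat derivative of the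
  ambient space; this is the connection it induces along \<open>\<phi>\<close>.
\<close>

definition conn ::
    "(pt \<Rightarrow> 'a::euclidean_space) \<Rightarrow> pt \<Rightarrow> (pt \<Rightarrow> 'a) \<Rightarrow> pt \<Rightarrow> 'a" where
  "conn \<phi> e V p = dir_deriv e V p - (dir_deriv e V p \<bullet> \<phi> p) *\<^sub>R \<phi> p"

definition tension :: "(pt \<Rightarrow> 'a::euclidean_space) \<Rightarrow> pt \<Rightarrow> 'a" where
  "tension \<phi> p = (\<Sum>e\<in>Basis. conn \<phi> e (dir_deriv e \<phi>) p)"

definition bienergy :: "(pt \<Rightarrow> 'a::euclidean_space) \<Rightarrow> real" where
  "bienergy \<phi> = 1 / 2 * integral (cbox (0, 0) (2 * pi, 2 * pi)) (\<lambda>p. (norm (tension \<phi> p))\<^sup>2)"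

definition biharmonic :: "(pt \<Rightarrow> 'a::euclidean_space) \<Rightarrow> bool" where
  "biharmonic \<phi> \<longleftrightarrow> torus_sphere_map \<phi> \<and>
     (\<forall>\<epsilon>>0. \<forall>\<Phi>. smooth_on ({-\<epsilon><..<\<epsilon>} \<times> UNIV) (\<lambda>(t, p). \<Phi> t p) \<longrightarrow>
        (\<forall>t\<in>{-\<epsilon><..<\<epsilon>}. torus_sphere_map (\<Phi> t)) \<longrightarrow> \<Phi> 0 = \<phi> \<longrightarrow>
        ((\<lambda>t. bienergy (\<Phi> t)) has_real_derivative 0) (at 0))"

definition proper_biharmonic :: "(pt \<Rightarrow> 'a::euclidean_space) \<Rightarrow> bool" where
  "proper_biharmonic \<phi> \<longleftrightarrow> biharmonic \<phi> \<and> (\<exists>p. tension \<phi> p \<noteq> 0)"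

definition rough_laplacian ::
    "(pt \<Rightarrow> 'a::euclidean_space) \<Rightarrow> (pt \<Rightarrow> 'a) \<Rightarrow> pt \<Rightarrow> 'a" where
  "rough_laplacian \<phi> V p = - (\<Sum>e\<in>Basis. conn \<phi> e (conn \<phi> e V) p)"

definition norm_d_sq :: "(pt \<Rightarrow> 'a::euclidean_space) \<Rightarrow> pt \<Rightarrow> real" where
  "norm_d_sq \<phi> p = (\<Sum>e\<in>Basis. (norm (dir_deriv e \<phi> p))\<^sup>2)"

definition T_op :: "(pt \<Rightarrow> 'a::euclidean_space) \<Rightarrow> (pt \<Rightarrow> 'a) \<Rightarrow> pt \<Rightarrow> 'a" where
  "T_op \<phi> V p = (\<Sum>e\<in>Basis. (V p \<bullet> dir_deriv e \<phi> p) *\<^sub>R dir_deriv e \<phi> p)"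

text \<open>\<open>\<langle>dV, d\<phi>\<rangle>\<close>, where \<open>dV\<close> is the covariant differential of a section \<open>V\<close> along \<open>\<phi>\<close>.\<close>

definition d_inner :: "(pt \<Rightarrow> 'a::euclidean_space) \<Rightarrow> (pt \<Rightarrow> 'a) \<Rightarrow> pt \<Rightarrow> real" where
  "d_inner \<phi> V p = (\<Sum>e\<in>Basis. conn \<phi> e V p \<bullet> dir_deriv e \<phi> p)"

text \<open>
  The second variation operator of the bienergy at a biharmonic map from the torus into a unit
  sphere.
\<close>

definition I2 :: "(pt \<Rightarrow> 'a::euclidean_space) \<Rightarrow> (pt \<Rightarrow> 'a) \<Rightarrow> pt \<Rightarrow> 'a" where
  "I2 \<phi> V p =
     rough_laplacian \<phi> (rough_laplacian \<phi> V) p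
   + rough_laplacian \<phi> (\<lambda>q. T_op \<phi> V q - norm_d_sq \<phi> q *\<^sub>R V q) p
   + (2 * d_inner \<phi> (tension \<phi>) p) *\<^sub>R V p
   + (norm (tension \<phi> p))\<^sup>2 *\<^sub>R V p
   - 2 *\<^sub>R (\<Sum>e\<in>Basis. (V p \<bullet> conn \<phi> e (tension \<phi>) p) *\<^sub>R dir_deriv e \<phi> p)
   - 2 *\<^sub>R (\<Sum>e\<in>Basis. (tension \<phi> p \<bullet> conn \<phi> e V p) *\<^sub>R dir_deriv e \<phi> p)
   - (tension \<phi> p \<bullet> V p) *\<^sub>R tension \<phi> p
   + T_op \<phi> (rough_laplacian \<phi> V) p
   + T_op \<phi> (T_op \<phi> V) p
   - (2 * norm_d_sq \<phi> p) *\<^sub>R T_op \<phi> V p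
   + (2 * d_inner \<phi> V p) *\<^sub>R tension \<phi> p
   - norm_d_sq \<phi> p *\<^sub>R rough_laplacian \<phi> V p
   + (norm_d_sq \<phi> p)\<^sup>2 *\<^sub>R V p"

definition eigenspace :: "(pt \<Rightarrow> 'a::euclidean_space) \<Rightarrow> real \<Rightarrow> (pt \<Rightarrow> 'a) set" where
  "eigenspace \<phi> \<mu> = {V \<in> sections \<phi>. \<forall>p. I2 \<phi> V p = \<mu> *\<^sub>R V p}"

definition is_eigenvalue :: "(pt \<Rightarrow> 'a::euclidean_space) \<Rightarrow> real \<Rightarrow> bool" where
  "is_eigenvalue \<phi> \<mu> \<longleftrightarrow> (\<exists>V\<in>eigenspace \<phi> \<mu>. \<exists>p. V p \<noteq> 0)"

abbreviation (input) scale_fun :: "real \<Rightarrow> (pt \<Rightarrow> 'a::euclidean_space) \<Rightarrow> pt \<Rightarrow> 'a" where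
  "scale_fun c V \<equiv> (\<lambda>p. c *\<^sub>R V p)"

lemma vector_space_scale_fun: "vector_space scale_fun"
  by unfold_locales (auto simp: fun_eq_iff algebra_simps)

text \<open>
  The library's \<open>dim\<close> is \<open>0\<close> on infinite-dimensional spaces, so a positive value also asserts
  that the eigenspace is finite-dimensional.
\<close>

definition eigen_multiplicity :: "(pt \<Rightarrow> 'a::euclidean_space) \<Rightarrow> real \<Rightarrow> nat" where
  "eigen_multiplicity \<phi> \<mu> = vector_space.dim scale_fun (eigenspace \<phi> \<mu>)"

definition alpha_star :: real where
  "alpha_star = pi / 4"

definition phi :: "nat \<Rightarrow> pt \<Rightarrow> real ^ 3" where
  "phi k = (\<lambda>(\<gamma>, \<theta>). vector [sin alpha_star * cos (real k * \<gamma>),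
                              sin alpha_star * sin (real k * \<gamma>),
                              cos alpha_star])"

text \<open>
  The entries of the list of eigenvalues.  The Boolean is the sign of the branch (\<open>True\<close> for \<open>+\<close>);
  for \<open>m = n = 0\<close> it distinguishes \<open>\<mu>\<^sub>0\<close> (\<open>True\<close>) from \<open>\<mu>\<^sub>1\<close> (\<open>False\<close>).
\<close>

definition pm :: "bool \<Rightarrow> real" where
  "pm s = (if s then 1 else -1)"

definition lambda_00 :: "real \<Rightarrow> bool \<Rightarrow> real" where
  "lambda_00 k s = (if s then 0 else - (k ^ 4))"

definition lambda_m0 :: "real \<Rightarrow> bool \<Rightarrow> real \<Rightarrow> real" where
  "lambda_m0 k s m = 1 / 2 * (- (k ^ 4) + 5 * k\<^sup>2 * m\<^sup>2 + 2 * m ^ 4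
     + pm s * sqrt (k ^ 8 + 2 * k ^ 6 * m\<^sup>2 + k ^ 4 * m ^ 4 + 32 * k\<^sup>2 * m ^ 6))"

definition lambda_0n :: "real \<Rightarrow> bool \<Rightarrow> real \<Rightarrow> real" where
  "lambda_0n k s n = (if s then n\<^sup>2 * (n\<^sup>2 + k\<^sup>2) else n ^ 4 - k ^ 4)"

definition lambda_mn :: "real \<Rightarrow> bool \<Rightarrow> real \<Rightarrow> real \<Rightarrow> real" where
  "lambda_mn k s m n = 1 / 2 * (- (k ^ 4) + k\<^sup>2 * (5 * m\<^sup>2 + n\<^sup>2) + 2 * (m\<^sup>2 + n\<^sup>2)\<^sup>2
     + pm s * sqrt (k ^ 8 + 2 * k ^ 6 * (m\<^sup>2 + n\<^sup>2) + k ^ 4 * (m\<^sup>2 + n\<^sup>2)\<^sup>2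
                    + 32 * k\<^sup>2 * m\<^sup>2 * (m\<^sup>2 + n\<^sup>2)\<^sup>2))"

definition entry :: "nat \<Rightarrow> nat \<times> nat \<times> bool \<Rightarrow> real" where
  "entry k = (\<lambda>(m, n, s).
     if m = 0 \<and> n = 0 then lambda_00 (real k) s
     else if n = 0 then lambda_m0 (real k) s (real m)
     else if m = 0 then lambda_0n (real k) s (real n)
     else lambda_mn (real k) s (real m) (real n))"

definition entry_mult :: "nat \<times> nat \<times> bool \<Rightarrow> nat" where
  "entry_mult = (\<lambda>(m, n, s).
     if m = 0 \<and> n = 0 then 1 else if m = 0 \<or> n = 0 then 2 else 4)"

end

theory Submission
  imports Defs
begin

text \<open>
  The image of \<open>\<phi> = phi k\<close> is a parallel of the sphere, and \<open>\<phi>\<^sup>-\<^sup>1 T\<S>\<^sup>2\<close> is trivialised by a periodic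
  orthonormal frame: \<open>e\<close> tangent to the parallel and \<open>n\<close> normal to it.  Write \<open>c\<close> for the constant
  speed \<open>|d\<phi>|\<close>, so that \<open>c\<^sup>2 = k\<^sup>2 / 2\<close>.  The frame rotates at a constant rate,
  \<open>\<nabla>\<^sub>\<gamma> e = - c n\<close> and \<open>\<nabla>\<^sub>\<gamma> n = c e\<close>, and \<open>\<tau>(\<phi>) = - c\<^sup>2 n\<close>.  Hence \<open>I\<^sub>2\<close> acts on the pair of components
  of a section \<open>f e + g n\<close> as a differential operator with constant coefficients (lemma \<open>I2_field\<close>).

  On plane waves \<open>f = a cos X\<close>, \<open>g = b sin X\<close> with \<open>X = m \<gamma> + n \<theta> - t\<close> this operator is a
  symmetric \<open>2 \<times> 2\<close> matrix acting on \<open>(a, b)\<close>, whose two eigenvalues are the entries with indices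
  \<open>\<bar>m\<bar>\<close> and \<open>\<bar>n\<bar>\<close> (lemma \<open>entry_eq_branch\<close>).  For each pair of natural numbers, the possible signs of the
  second frequency and the phases \<open>0\<close> and \<open>\<pi> / 2\<close> give as many eigensections as the stated
  multiplicity (lemma \<open>card_fibre\<close>).

  These modes exhaust the spectrum.  They are pairwise orthogonal in \<open>L\<^sup>2\<close>; integration by parts
  against an explicit mode shows that an eigensection for \<open>\<mu>\<close> is orthogonal to all modes with another
  eigenvalue (lemma \<open>pairing_eigensection_mode\<close>); and a section orthogonal to all modes vanishes
  (lemma \<open>modes_complete\<close>), since the trigonometric polynomials are uniformly dense in the continuous
  functions on the torus by the Stone-Weierstrass theorem.  So the modes with eigenvalue \<open>\<mu>\<close> form a
  basis of the eigenspace.  There are finitely many of them, because the entries tend to infinity.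

  Biharmonicity is checked on an arbitrary variation \<open>\<Phi>\<^sub>t\<close> (lemma \<open>biharmonic_phi\<close>).  As \<open>|\<Phi>\<^sub>t| = 1\<close>,
  the energy density is \<open>|L|\<^sup>2 - \<langle>L, \<Phi>\<^sub>t\<rangle>\<^sup>2\<close> with \<open>L\<close> the flat Laplacian of \<open>\<Phi>\<^sub>t\<close>.  Its derivative at
  \<open>t = 0\<close> is a combination of \<open>\<langle>\<partial>\<^sub>t L, n\<rangle>\<close> and \<open>\<langle>\<partial>\<^sub>t \<Phi>, \<Delta> \<phi>\<rangle>\<close> with opposite coefficients.  Integration by
  parts turns the first into \<open>\<langle>\<partial>\<^sub>t \<Phi>, \<Delta> n\<rangle>\<close>, and \<open>\<Delta> n = \<Delta> \<phi> = - c\<^sup>2 (\<phi> + n)\<close>.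
\<close>

section \<open>Calculus of smooth functions\<close>

lemma dir_deriv_eq: "(f has_derivative f') (at p) \<Longrightarrow> dir_deriv v f p = f' v"
  unfolding dir_deriv_def using frechet_derivative_at by metis

lemma has_derivative_dir_deriv:
  "f differentiable (at p) \<Longrightarrow> (f has_derivative (\<lambda>v. dir_deriv v f p)) (at p)"
  unfolding dir_deriv_def using frechet_derivative_works by metis

lemma has_vector_derivative_along_curve:
  assumes "(c has_vector_derivative v) (at t within X)" "f differentiable (at (c t))"
  shows "((\<lambda>s. f (c s)) has_vector_derivative dir_deriv v f (c t)) (at t within X)"
proof -
  have "((\<lambda>s. f (c s)) has_derivative (\<lambda>h. dir_deriv (h *\<^sub>R v) f (c t))) (at t within X)"
    using has_derivative_compose[OF assms(1)[unfolded has_vector_derivative_def]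
        has_derivative_dir_deriv[OF assms(2)]] .
  moreover have "(\<lambda>h. dir_deriv (h *\<^sub>R v) f (c t)) = (\<lambda>h. h *\<^sub>R dir_deriv v f (c t))"
    unfolding dir_deriv_def by (rule ext, rule linear_scale[OF linear_frechet_derivative[OF assms(2)]])
  ultimately show ?thesis
    unfolding has_vector_derivative_def by (rule has_derivative_eq_rhs)
qed

lemma dir_deriv_const [simp]: "dir_deriv v (\<lambda>p. c) = (\<lambda>p. 0)"
  by (simp add: fun_eq_iff dir_deriv_def)

lemma dir_deriv_add_at:
  assumes "f differentiable (at p)" "g differentiable (at p)"
  shows "dir_deriv v (\<lambda>p. f p + g p) p = dir_deriv v f p + dir_deriv v g p"
  by (rule dir_deriv_eq) (intro has_derivative_add has_derivative_dir_deriv assms)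

lemma (in bounded_bilinear) dir_deriv_prod:
  assumes "f differentiable (at p)" "g differentiable (at p)"
  shows "dir_deriv v (\<lambda>p. prod (f p) (g p)) p = prod (f p) (dir_deriv v g p) + prod (dir_deriv v f p) (g p)"
  by (rule dir_deriv_eq) (intro FDERIV has_derivative_dir_deriv assms)

lemma smooth_on_continuous: "smooth_on S f \<Longrightarrow> continuous_on S f"
  unfolding smooth_on_def using Ck_on.simps(1) by blast

lemma smooth_on_differentiable: "smooth_on S f \<Longrightarrow> p \<in> S \<Longrightarrow> f differentiable (at p)"
  unfolding smooth_on_def using Ck_on.simps(2) by blast

lemma smooth_on_dir_deriv: "smooth_on S f \<Longrightarrow> smooth_on S (dir_deriv v f)"
  unfolding smooth_on_def using Ck_on.simps(2) by blast

lemma Ck_on_lower: "Ck_on (Suc k) S f \<Longrightarrow> Ck_on k S f"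
proof (induction k arbitrary: f)
  case 0
  then show ?case
    by (auto intro!: differentiable_imp_continuous_on differentiable_at_imp_differentiable_on)
qed auto

lemma Ck_on_const: "Ck_on k S (\<lambda>p. c)"
  by (induction k arbitrary: c) auto

text \<open>
  Closure under sums and products is proved at every finite order, by induction: the derivative of
  a product is a sum of products of lower order, so smoothness alone is too coarse a hypothesis.
\<close>

lemma Ck_on_add:
  "Ck_on k UNIV f \<Longrightarrow> Ck_on k UNIV g \<Longrightarrow> Ck_on k UNIV (\<lambda>p. f p + g p)"
proof (induction k arbitrary: f g)
  case 0
  then show ?case by (simp add: continuous_on_add)
next
  case (Suc k)
  have "dir_deriv v (\<lambda>p. f p + g p) = (\<lambda>p. dir_deriv v f p + dir_deriv v g p)" for v
    using Suc.prems by (auto simp: fun_eq_iff dir_deriv_add_at)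
  with Suc show ?case by (auto intro: differentiable_add)
qed

lemma (in bounded_bilinear) Ck_on_prod:
  "Ck_on k UNIV f \<Longrightarrow> Ck_on k UNIV g \<Longrightarrow> Ck_on k UNIV (\<lambda>p. prod (f p) (g p))"
proof (induction k arbitrary: f g)
  case 0
  then show ?case by (auto intro: continuous_on)
next
  case (Suc k)
  have "dir_deriv v (\<lambda>p. prod (f p) (g p)) =
      (\<lambda>p. prod (f p) (dir_deriv v g p) + prod (dir_deriv v f p) (g p))" for v
    using Suc.prems by (auto simp: fun_eq_iff dir_deriv_prod)
  moreover have "(\<lambda>p. prod (f p) (g p)) differentiable (at p)" for p
    using FDERIV[OF has_derivative_dir_deriv has_derivative_dir_deriv, of f p g] Suc.prems
    by (auto intro: differentiableI)
  moreover have "Ck_on k UNIV f" "Ck_on k UNIV g"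
    using Suc.prems Ck_on_lower by blast+
  ultimately show ?case
    using Suc.prems by (auto intro!: Ck_on_add Suc.IH)
qed

lemma smooth_const: "smooth_on S (\<lambda>p. c)"
  by (simp add: smooth_on_def Ck_on_const)

lemma smooth_add: "smooth_on UNIV f \<Longrightarrow> smooth_on UNIV g \<Longrightarrow> smooth_on UNIV (\<lambda>p. f p + g p)"
  by (simp add: smooth_on_def Ck_on_add)

lemma smooth_scaleR:
  "smooth_on UNIV f \<Longrightarrow> smooth_on UNIV g \<Longrightarrow> smooth_on UNIV (\<lambda>p. f p *\<^sub>R g p)"
  by (simp add: smooth_on_def bounded_bilinear.Ck_on_prod[OF bounded_bilinear_scaleR])

lemma smooth_inner:
  "smooth_on UNIV f \<Longrightarrow> smooth_on UNIV g \<Longrightarrow> smooth_on UNIV (\<lambda>p. f p \<bullet> g p)"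
  by (simp add: smooth_on_def bounded_bilinear.Ck_on_prod[OF bounded_bilinear_inner])

lemma smooth_mult:
  fixes f g :: "'b::real_normed_vector \<Rightarrow> real"
  shows "smooth_on UNIV f \<Longrightarrow> smooth_on UNIV g \<Longrightarrow> smooth_on UNIV (\<lambda>p. f p * g p)"
  using smooth_scaleR[of f g] by simp

lemma smooth_uminus:
  assumes "smooth_on UNIV f" shows "smooth_on UNIV (\<lambda>p. - f p)"
  using smooth_scaleR[OF smooth_const[of UNIV "-1"] assms] by simp

lemma smooth_diff:
  "smooth_on UNIV f \<Longrightarrow> smooth_on UNIV g \<Longrightarrow> smooth_on UNIV (\<lambda>p. f p - g p)"
  using smooth_add[OF _ smooth_uminus, of f g] by simp

lemmas smooth_intros = smooth_const smooth_add smooth_scaleR smooth_inner smooth_mult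
  smooth_uminus smooth_diff smooth_on_dir_deriv

text \<open>
  For functions that are smooth on the whole space the rules of differentiation hold as identities
  of functions, which lets them rewrite under further derivatives.
\<close>

lemma dir_deriv_add:
  assumes "smooth_on UNIV f" "smooth_on UNIV g"
  shows "dir_deriv v (\<lambda>p. f p + g p) = (\<lambda>p. dir_deriv v f p + dir_deriv v g p)"
  using assms by (auto simp: fun_eq_iff dir_deriv_add_at smooth_on_differentiable)

lemma dir_deriv_scaleR:
  assumes "smooth_on UNIV f" "smooth_on UNIV g"
  shows "dir_deriv v (\<lambda>p. f p *\<^sub>R g p) = (\<lambda>p. f p *\<^sub>R dir_deriv v g p + dir_deriv v f p *\<^sub>R g p)"
  using assms by (auto simp: fun_eq_iff smooth_on_differentiable
      bounded_bilinear.dir_deriv_prod[OF bounded_bilinear_scaleR])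

lemma dir_deriv_inner:
  assumes "smooth_on UNIV f" "smooth_on UNIV g"
  shows "dir_deriv v (\<lambda>p. f p \<bullet> g p) = (\<lambda>p. f p \<bullet> dir_deriv v g p + dir_deriv v f p \<bullet> g p)"
  using assms by (auto simp: fun_eq_iff smooth_on_differentiable
      bounded_bilinear.dir_deriv_prod[OF bounded_bilinear_inner])

lemma dir_deriv_mult:
  fixes f g :: "'b::real_normed_vector \<Rightarrow> real"
  assumes "smooth_on UNIV f" "smooth_on UNIV g"
  shows "dir_deriv v (\<lambda>p. f p * g p) = (\<lambda>p. f p * dir_deriv v g p + dir_deriv v f p * g p)"
  using dir_deriv_scaleR[OF assms] by simp

lemma dir_deriv_cmult:
  fixes f :: "'b::real_normed_vector \<Rightarrow> real"
  assumes "smooth_on UNIV f"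
  shows "dir_deriv v (\<lambda>p. c * f p) = (\<lambda>p. c * dir_deriv v f p)"
  using dir_deriv_mult[OF smooth_const assms, of v c] by simp

lemma dir_deriv_uminus:
  assumes "smooth_on UNIV f"
  shows "dir_deriv v (\<lambda>p. - f p) = (\<lambda>p. - dir_deriv v f p)"
  using dir_deriv_scaleR[OF smooth_const assms, of v "-1"] by simp

lemma dir_deriv_diff:
  assumes "smooth_on UNIV f" "smooth_on UNIV g"
  shows "dir_deriv v (\<lambda>p. f p - g p) = (\<lambda>p. dir_deriv v f p - dir_deriv v g p)"
  using dir_deriv_add[OF assms(1) smooth_uminus[OF assms(2)]] dir_deriv_uminus[OF assms(2)]
  by simp

lemmas dir_deriv_rules = dir_deriv_add dir_deriv_diff dir_deriv_uminus dir_deriv_cmult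
  dir_deriv_mult dir_deriv_scaleR dir_deriv_inner

section \<open>Periodic functions and integration by parts on the torus\<close>

lemma
  fixes f g :: "pt \<Rightarrow> 'a::real_vector" and a b :: "pt \<Rightarrow> real" and u v :: "pt \<Rightarrow> 'b::real_inner"
  shows periodic_const: "torus_periodic (\<lambda>p. c)"
    and periodic_add: "torus_periodic f \<Longrightarrow> torus_periodic g \<Longrightarrow> torus_periodic (\<lambda>p. f p + g p)"
    and periodic_diff: "torus_periodic f \<Longrightarrow> torus_periodic g \<Longrightarrow> torus_periodic (\<lambda>p. f p - g p)"
    and periodic_uminus: "torus_periodic f \<Longrightarrow> torus_periodic (\<lambda>p. - f p)"
    and periodic_mult: "torus_periodic a \<Longrightarrow> torus_periodic b \<Longrightarrow> torus_periodic (\<lambda>p. a p * b p)"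
    and periodic_scaleR: "torus_periodic a \<Longrightarrow> torus_periodic g \<Longrightarrow> torus_periodic (\<lambda>p. a p *\<^sub>R g p)"
    and periodic_inner: "torus_periodic u \<Longrightarrow> torus_periodic v \<Longrightarrow> torus_periodic (\<lambda>p. u p \<bullet> v p)"
  by (simp_all add: torus_periodic_def)

lemma torus_periodic_iff:
  "torus_periodic f \<longleftrightarrow> (\<forall>p. f (p + (2 * pi, 0)) = f p \<and> f (p + (0, 2 * pi)) = f p)"
  by (auto simp: torus_periodic_def)

lemma dir_deriv_translate:
  assumes "f differentiable (at (p + a))"
  shows "dir_deriv v (\<lambda>q. f (q + a)) p = dir_deriv v f (p + a)"
proof (rule dir_deriv_eq)
  have "((\<lambda>q. q + a) has_derivative (\<lambda>v. v)) (at p)"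
    by (auto intro!: derivative_eq_intros)
  from has_derivative_compose[OF this has_derivative_dir_deriv[OF assms]]
  show "((\<lambda>q. f (q + a)) has_derivative (\<lambda>v. dir_deriv v f (p + a))) (at p)" .
qed

lemma periodic_dir_deriv:
  assumes "smooth_on UNIV f" "torus_periodic f"
  shows "torus_periodic (dir_deriv v f)"
proof -
  have "dir_deriv v f (p + a) = dir_deriv v f p" if "\<And>p. f (p + a) = f p" for p a
    using dir_deriv_translate[of f p a v] assms(1) that
    by (simp add: smooth_on_differentiable)
  then show ?thesis using assms(2) unfolding torus_periodic_iff by blast
qed

lemmas periodic_intros = periodic_const periodic_add periodic_diff periodic_uminus periodic_mult
  periodic_scaleR periodic_inner periodic_dir_deriv

abbreviation D1 :: "(pt \<Rightarrow> 'a::real_normed_vector) \<Rightarrow> pt \<Rightarrow> 'a" where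
  "D1 \<equiv> dir_deriv (1, 0)"

abbreviation D2 :: "(pt \<Rightarrow> 'a::real_normed_vector) \<Rightarrow> pt \<Rightarrow> 'a" where
  "D2 \<equiv> dir_deriv (0, 1)"

abbreviation torus_integral :: "(pt \<Rightarrow> real) \<Rightarrow> real" where
  "torus_integral \<equiv> integral (cbox (0, 0) (2 * pi, 2 * pi))"

lemma Basis_pt: "(Basis :: pt set) = {(1, 0), (0, 1)}"
  by (auto simp: Basis_prod_def)

lemma sum_Basis_pt: "(\<Sum>e\<in>(Basis :: pt set). h e) = h (1, 0) + h (0, 1)"
  unfolding Basis_pt by simp

text \<open>
  The divergence theorem on the torus: in each variable separately the fundamental theorem of
  calculus leaves boundary terms that cancel by periodicity.
\<close>

lemma
  fixes w :: "pt \<Rightarrow> real"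
  assumes w: "smooth_on UNIV w" "torus_periodic w"
  shows torus_integral_D1: "torus_integral (D1 w) = 0"
    and torus_integral_D2: "torus_integral (D2 w) = 0"
proof -
  have cont: "continuous_on S (dir_deriv v w)" for v S
    using smooth_on_continuous[OF smooth_on_dir_deriv[OF w(1)]] continuous_on_subset by blast
  have diff: "w differentiable (at p)" for p
    using w(1) by (simp add: smooth_on_differentiable)
  have "((\<lambda>x. (x, y)) has_vector_derivative (1, 0)) (at x within X)"
    "((\<lambda>y. (x, y)) has_vector_derivative (0, 1)) (at y within X)" for x y :: real and X
    by (auto simp: has_vector_derivative_def intro!: derivative_eq_intros)
  note line = this[THEN has_vector_derivative_along_curve, OF diff]
  have per: "w (2 * pi, y) = w (0, y)" "w (x, 2 * pi) = w (x, 0)" for x y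
    using w(2)[unfolded torus_periodic_def, rule_format, of 0 y]
      w(2)[unfolded torus_periodic_def, rule_format, of x 0] by simp_all
  have "integral {0..2 * pi} (\<lambda>x. D1 w (x, y)) = 0" for y
    using integral_unique[OF fundamental_theorem_of_calculus[of 0 "2 * pi" "\<lambda>x. w (x, y)", OF _ line(1)]] per
    by simp
  moreover have "torus_integral (D1 w) =
      integral {0..2 * pi} (\<lambda>y. integral {0..2 * pi} (\<lambda>x. D1 w (x, y)))"
    unfolding integral_prod_continuous[OF cont]
    using integral_swap_continuous[of 0 0 "2 * pi" "2 * pi" "\<lambda>x y. D1 w (x, y)"] cont
    by (simp only: case_prod_eta interval_cbox)
  ultimately show "torus_integral (D1 w) = 0" by simp
  have "integral {0..2 * pi} (\<lambda>y. D2 w (x, y)) = 0" for x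
    using integral_unique[OF fundamental_theorem_of_calculus[of 0 "2 * pi" "\<lambda>y. w (x, y)", OF _ line(2)]] per
    by simp
  then show "torus_integral (D2 w) = 0"
    using integral_prod_continuous[OF cont] by simp
qed

lemma smooth_integrable:
  fixes f :: "pt \<Rightarrow> real"
  shows "smooth_on UNIV f \<Longrightarrow> f integrable_on cbox a b"
  by (rule integrable_continuous, rule continuous_on_subset[OF smooth_on_continuous]) auto

lemma torus_integral_dir_deriv:
  fixes w :: "pt \<Rightarrow> real"
  assumes "v \<in> Basis" "smooth_on UNIV w" "torus_periodic w"
  shows "torus_integral (dir_deriv v w) = 0"
  using assms torus_integral_D1[OF assms(2,3)] torus_integral_D2[OF assms(2,3)]
  by (auto simp: Basis_prod_def)

lemma integral_by_parts:
  fixes f g :: "pt \<Rightarrow> 'a::real_inner"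
  assumes "v \<in> Basis" "smooth_on UNIV f" "torus_periodic f" "smooth_on UNIV g" "torus_periodic g"
  shows "torus_integral (\<lambda>p. dir_deriv v f p \<bullet> g p) = - torus_integral (\<lambda>p. f p \<bullet> dir_deriv v g p)"
proof -
  have "torus_integral (dir_deriv v (\<lambda>p. f p \<bullet> g p)) = 0"
    by (intro torus_integral_dir_deriv smooth_intros periodic_inner assms)
  moreover have "torus_integral (\<lambda>p. f p \<bullet> dir_deriv v g p + dir_deriv v f p \<bullet> g p) =
      torus_integral (\<lambda>p. f p \<bullet> dir_deriv v g p) + torus_integral (\<lambda>p. dir_deriv v f p \<bullet> g p)"
    by (intro integral_add smooth_integrable smooth_intros assms)
  ultimately show ?thesis by (simp add: dir_deriv_inner assms)
qed

section \<open>Plane waves\<close>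

definition cos_wave :: "real \<Rightarrow> real \<Rightarrow> real \<Rightarrow> pt \<Rightarrow> real" where
  "cos_wave m n a p = cos (m * fst p + n * snd p - a)"

definition sin_wave :: "real \<Rightarrow> real \<Rightarrow> real \<Rightarrow> pt \<Rightarrow> real" where
  "sin_wave m n a p = sin (m * fst p + n * snd p - a)"

lemma has_derivative_cos_wave:
  "(cos_wave m n a has_derivative (\<lambda>v. - (m * fst v + n * snd v) * sin_wave m n a p)) (at p)"
  unfolding cos_wave_def sin_wave_def
  by (auto intro!: derivative_eq_intros simp: fun_eq_iff algebra_simps)

lemma has_derivative_sin_wave:
  "(sin_wave m n a has_derivative (\<lambda>v. (m * fst v + n * snd v) * cos_wave m n a p)) (at p)"
  unfolding cos_wave_def sin_wave_def
  by (auto intro!: derivative_eq_intros simp: fun_eq_iff algebra_simps)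

lemma dir_deriv_cos_wave:
  "dir_deriv v (cos_wave m n a) = (\<lambda>p. - (m * fst v + n * snd v) * sin_wave m n a p)"
  by (rule ext, rule dir_deriv_eq, rule has_derivative_cos_wave)

lemma dir_deriv_sin_wave:
  "dir_deriv v (sin_wave m n a) = (\<lambda>p. (m * fst v + n * snd v) * cos_wave m n a p)"
  by (rule ext, rule dir_deriv_eq, rule has_derivative_sin_wave)

lemma
  shows smooth_cos_wave: "smooth_on UNIV (cos_wave m n a)"
    and smooth_sin_wave: "smooth_on UNIV (sin_wave m n a)"
proof -
  have diff: "cos_wave m n a differentiable (at p)" "sin_wave m n a differentiable (at p)" for p
    using has_derivative_cos_wave has_derivative_sin_wave differentiableI by blast+
  have cont: "continuous_on UNIV (cos_wave m n a)" "continuous_on UNIV (sin_wave m n a)"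
    unfolding cos_wave_def sin_wave_def by (intro continuous_intros)+
  have "Ck_on k UNIV (cos_wave m n a) \<and> Ck_on k UNIV (sin_wave m n a)" for k
  proof (induction k)
    case (Suc k)
    have "Ck_on k UNIV (\<lambda>p. c * f p)" if "Ck_on k UNIV f" for c and f :: "pt \<Rightarrow> real"
      by (rule bounded_bilinear.Ck_on_prod[OF bounded_bilinear_mult Ck_on_const that])
    with Suc show ?case
      by (simp only: Ck_on.simps dir_deriv_cos_wave dir_deriv_sin_wave diff simp_thms ball_simps)
  qed (simp add: cont)
  then show "smooth_on UNIV (cos_wave m n a)" "smooth_on UNIV (sin_wave m n a)"
    by (simp_all add: smooth_on_def)
qed

lemma
  assumes "m \<in> \<int>" "n \<in> \<int>"
  shows periodic_cos_wave: "torus_periodic (cos_wave m n a)"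
    and periodic_sin_wave: "torus_periodic (sin_wave m n a)"
proof -
  have "cos (t + 2 * pi * r) = cos t" "sin (t + 2 * pi * r) = sin t" if "r \<in> \<int>" for t r :: real
    using that sin.plus_of_int[of t] cos.plus_of_int[of t] by (auto elim!: Ints_cases simp: mult.commute)
  note * = this[OF assms(1)] this[OF assms(2)]
  have "m * (x + 2 * pi) + n * y - a = m * x + n * y - a + 2 * pi * m"
    "m * x + n * (y + 2 * pi) - a = m * x + n * y - a + 2 * pi * n" for x y
    by (simp_all add: algebra_simps)
  then show "torus_periodic (cos_wave m n a)" "torus_periodic (sin_wave m n a)"
    unfolding torus_periodic_def cos_wave_def sin_wave_def fst_conv snd_conv by (simp_all only: * simp_thms)
qed

lemma
  shows cos_wave_mult_cos_wave: "cos_wave m n a p * cos_wave m' n' a' p =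
      1 / 2 * cos_wave (m - m') (n - n') (a - a') p + 1 / 2 * cos_wave (m + m') (n + n') (a + a') p"
    and sin_wave_mult_sin_wave: "sin_wave m n a p * sin_wave m' n' a' p =
      1 / 2 * cos_wave (m - m') (n - n') (a - a') p - 1 / 2 * cos_wave (m + m') (n + n') (a + a') p"
proof -
  define x y where "x = m * fst p + n * snd p - a" and "y = m' * fst p + n' * snd p - a'"
  have xy: "(m - m') * fst p + (n - n') * snd p - (a - a') = x - y"
    "(m + m') * fst p + (n + n') * snd p - (a + a') = x + y"
    by (simp_all add: x_def y_def algebra_simps)
  show "cos_wave m n a p * cos_wave m' n' a' p =
      1 / 2 * cos_wave (m - m') (n - n') (a - a') p + 1 / 2 * cos_wave (m + m') (n + n') (a + a') p"
    "sin_wave m n a p * sin_wave m' n' a' p =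
      1 / 2 * cos_wave (m - m') (n - n') (a - a') p - 1 / 2 * cos_wave (m + m') (n + n') (a + a') p"
    unfolding cos_wave_def sin_wave_def xy unfolding x_def[symmetric] y_def[symmetric]
    by (simp_all only: cos_diff cos_add) (simp_all add: field_simps)
qed

section \<open>The orthonormal frame along the map\<close>

definition frame_e :: "nat \<Rightarrow> pt \<Rightarrow> real ^ 3" where
  "frame_e k = (\<lambda>p. (- sin_wave k 0 0 p) *\<^sub>R axis 1 1 + cos_wave k 0 0 p *\<^sub>R axis 2 1)"

definition frame_n :: "nat \<Rightarrow> pt \<Rightarrow> real ^ 3" where
  "frame_n k = (\<lambda>p. (sqrt 2 / 2) *\<^sub>R (cos_wave k 0 0 p *\<^sub>R axis 1 1 + sin_wave k 0 0 p *\<^sub>R axis 2 1 - axis 3 1))"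

text \<open>
  The norm of the differential of the map, which is constant: \<open>k sin (\<pi> / 4)\<close>.
\<close>

definition speed :: "nat \<Rightarrow> real" where
  "speed k = k * (sqrt 2 / 2)"

lemma speed_pos: "k \<ge> 1 \<Longrightarrow> speed k > 0"
  by (simp add: speed_def)

lemma phi_eq:
  "phi k = (\<lambda>p. (sqrt 2 / 2) *\<^sub>R (cos_wave k 0 0 p *\<^sub>R axis 1 1 + sin_wave k 0 0 p *\<^sub>R axis 2 1 + axis 3 1))"
proof
  fix p :: pt
  obtain x y where "p = (x, y)" by (cases p)
  then show "phi k p = (sqrt 2 / 2) *\<^sub>R (cos_wave k 0 0 p *\<^sub>R axis 1 1 + sin_wave k 0 0 p *\<^sub>R axis 2 1 + axis 3 1)"
    by (simp add: phi_def alpha_star_def sin_45 cos_45 cos_wave_def sin_wave_def vec_eq_iff forall_3 axis_def)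
qed

lemmas smooth_wave = smooth_cos_wave smooth_sin_wave

lemma smooth_frame:
  "smooth_on UNIV (frame_e k)" "smooth_on UNIV (frame_n k)" "smooth_on UNIV (phi k)"
  unfolding frame_e_def frame_n_def phi_eq by (intro smooth_intros smooth_wave)+

lemma periodic_frame:
  "torus_periodic (frame_e k)" "torus_periodic (frame_n k)" "torus_periodic (phi k)"
  unfolding frame_e_def frame_n_def phi_eq
  by (intro periodic_intros periodic_cos_wave periodic_sin_wave; simp)+

lemma sin_cos_wave_square: "sin_wave m n a p * sin_wave m n a p = 1 - cos_wave m n a p * cos_wave m n a p"
  unfolding cos_wave_def sin_wave_def using sin_squared_eq by (simp add: power2_eq_square)

lemma inner_frame:
  "frame_e k p \<bullet> frame_e k p = 1" "frame_n k p \<bullet> frame_n k p = 1" "phi k p \<bullet> phi k p = 1"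
  "frame_e k p \<bullet> frame_n k p = 0" "frame_n k p \<bullet> frame_e k p = 0"
  "frame_e k p \<bullet> phi k p = 0" "phi k p \<bullet> frame_e k p = 0"
  "frame_n k p \<bullet> phi k p = 0" "phi k p \<bullet> frame_n k p = 0"
proof -
  have sq: "sqrt 2 * (sqrt 2 * t) = 2 * t" for t by (simp flip: mult.assoc)
  show "frame_e k p \<bullet> frame_e k p = 1" "frame_n k p \<bullet> frame_n k p = 1" "phi k p \<bullet> phi k p = 1"
    "frame_e k p \<bullet> frame_n k p = 0" "frame_n k p \<bullet> frame_e k p = 0"
    "frame_e k p \<bullet> phi k p = 0" "phi k p \<bullet> frame_e k p = 0"
    "frame_n k p \<bullet> phi k p = 0" "phi k p \<bullet> frame_n k p = 0"
    by (simp_all add: frame_e_def frame_n_def phi_eq inner_vec_def sum_3 axis_def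
      algebra_simps diff_divide_distrib sin_cos_wave_square sq)
qed

lemma dir_deriv_frame_e:
  "dir_deriv v (frame_e k) = (\<lambda>p. - (speed k * fst v) *\<^sub>R (phi k p + frame_n k p))"
  unfolding frame_e_def frame_n_def phi_eq
  by (simp add: dir_deriv_rules smooth_intros smooth_wave dir_deriv_cos_wave dir_deriv_sin_wave)
    (rule ext, simp add: vec_eq_iff forall_3 axis_def speed_def)

lemma dir_deriv_phi: "dir_deriv v (phi k) = (\<lambda>p. (speed k * fst v) *\<^sub>R frame_e k p)"
  unfolding frame_e_def phi_eq
  by (simp add: dir_deriv_rules smooth_intros smooth_wave dir_deriv_cos_wave dir_deriv_sin_wave)
    (rule ext, simp add: vec_eq_iff forall_3 axis_def speed_def)

lemma dir_deriv_frame_n: "dir_deriv v (frame_n k) = (\<lambda>p. (speed k * fst v) *\<^sub>R frame_e k p)"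
  unfolding frame_e_def frame_n_def
  by (simp add: dir_deriv_rules smooth_intros smooth_wave dir_deriv_cos_wave dir_deriv_sin_wave)
    (rule ext, simp add: vec_eq_iff forall_3 axis_def speed_def)

definition in_frame :: "nat \<Rightarrow> pt \<Rightarrow> real \<Rightarrow> real \<Rightarrow> real ^ 3" where
  "in_frame k p a b = a *\<^sub>R frame_e k p + b *\<^sub>R frame_n k p"

lemma in_frame_algebra:
  "in_frame k p a b + in_frame k p a' b' = in_frame k p (a + a') (b + b')"
  "in_frame k p a b - in_frame k p a' b' = in_frame k p (a - a') (b - b')"
  "- in_frame k p a b = in_frame k p (- a) (- b)"
  "r *\<^sub>R in_frame k p a b = in_frame k p (r * a) (r * b)"
  by (simp_all add: in_frame_def algebra_simps)

lemma in_frame_inner: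
  "in_frame k p a b \<bullet> in_frame k p a' b' = a * a' + b * b'"
  by (simp add: in_frame_def inner_add_left inner_add_right inner_frame)

lemma in_frame_inner_phi: "in_frame k p a b \<bullet> phi k p = 0"
  by (simp add: in_frame_def inner_add_left inner_frame)

lemma in_frame_eq_iff: "in_frame k p a b = in_frame k p a' b' \<longleftrightarrow> a = a' \<and> b = b'"
proof
  assume eq: "in_frame k p a b = in_frame k p a' b'"
  have "in_frame k p a b \<bullet> in_frame k p 1 0 = in_frame k p a' b' \<bullet> in_frame k p 1 0"
    "in_frame k p a b \<bullet> in_frame k p 0 1 = in_frame k p a' b' \<bullet> in_frame k p 0 1"
    using eq by simp_all
  then show "a = a' \<and> b = b'" by (simp add: in_frame_inner)
qed simp

text \<open>
  The vectors \<open>e\<close>, \<open>n\<close>, \<open>\<phi>\<close> form an orthonormal basis of the ambient space at every point.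
\<close>

lemma frame_expansion:
  fixes V :: "real ^ 3"
  shows "V = in_frame k p (V \<bullet> frame_e k p) (V \<bullet> frame_n k p) + (V \<bullet> phi k p) *\<^sub>R phi k p"
proof -
  define s c h where "s = sin_wave k 0 0 p" and "c = cos_wave k 0 0 p" and "h = sqrt 2 / 2"
  define a b d where "a = V $ 1" and "b = V $ 2" and "d = V $ 3"
  have "s * s = 1 - c * c" "h * h = 1 / 2"
    using sin_cos_wave_square[of k 0 0 p] by (simp_all add: s_def c_def h_def)
  then have
    "a = (b * c - a * s) * (- s) + (h * (a * c + b * s - d)) * (h * c) + (h * (a * c + b * s + d)) * (h * c)"
    "b = (b * c - a * s) * c + (h * (a * c + b * s - d)) * (h * s) + (h * (a * c + b * s + d)) * (h * s)"
    "d = (h * (a * c + b * s - d)) * (- h) + (h * (a * c + b * s + d)) * h"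
    by algebra+
  then show ?thesis
    unfolding in_frame_def frame_e_def frame_n_def phi_eq s_def[symmetric] c_def[symmetric] h_def[symmetric]
    by (simp add: vec_eq_iff forall_3 inner_vec_def sum_3 axis_def flip: a_def b_def d_def)
       (simp add: algebra_simps)
qed

section \<open>The second variation operator in frame coordinates\<close>

text \<open>
  Every section along the map has this form, with smooth periodic components, so an operator on
  sections is determined by its action on pairs of functions.
\<close>

definition tangent_field :: "nat \<Rightarrow> (pt \<Rightarrow> real) \<Rightarrow> (pt \<Rightarrow> real) \<Rightarrow> pt \<Rightarrow> real ^ 3" where
  "tangent_field k f g p = in_frame k p (f p) (g p)"

lemma tangent_field_in_sections:
  assumes "smooth_on UNIV f" "torus_periodic f" "smooth_on UNIV g" "torus_periodic g"
  shows "tangent_field k f g \<in> sections (phi k)"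
proof -
  have "tangent_field k f g = (\<lambda>p. f p *\<^sub>R frame_e k p + g p *\<^sub>R frame_n k p)"
    by (rule ext) (simp add: tangent_field_def in_frame_def)
  moreover have "smooth_on UNIV \<dots>" "torus_periodic \<dots>"
    by (intro smooth_intros periodic_intros smooth_frame periodic_frame assms)+
  ultimately have "smooth_on UNIV (tangent_field k f g)" "torus_periodic (tangent_field k f g)" by simp_all
  then show ?thesis
    by (simp add: sections_def tangent_field_def in_frame_inner_phi)
qed

lemma sectionsE:
  assumes "V \<in> sections (phi k)"
  obtains f g where "V = tangent_field k f g" "smooth_on UNIV f" "torus_periodic f"
    "smooth_on UNIV g" "torus_periodic g"
proof
  show "V = tangent_field k (\<lambda>p. V p \<bullet> frame_e k p) (\<lambda>p. V p \<bullet> frame_n k p)"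
  proof
    fix p
    have "V p \<bullet> phi k p = 0" using assms unfolding sections_def by blast
    then show "V p = tangent_field k (\<lambda>p. V p \<bullet> frame_e k p) (\<lambda>p. V p \<bullet> frame_n k p) p"
      using frame_expansion[of "V p" k p] by (simp add: tangent_field_def)
  qed
  show "smooth_on UNIV (\<lambda>p. V p \<bullet> frame_e k p)" "smooth_on UNIV (\<lambda>p. V p \<bullet> frame_n k p)"
    "torus_periodic (\<lambda>p. V p \<bullet> frame_e k p)" "torus_periodic (\<lambda>p. V p \<bullet> frame_n k p)"
    using assms by (auto simp: sections_def intro!: smooth_inner smooth_frame periodic_inner periodic_frame)
qed

text \<open>
  The derivatives of the frame contribute the terms of order zero: \<open>\<nabla>\<^sub>\<gamma>\<close> is \<open>\<partial>\<^sub>\<gamma>\<close> plus \<open>c\<close> times the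
  rotation by a right angle, and \<open>\<nabla>\<^sub>\<theta>\<close> is \<open>\<partial>\<^sub>\<theta>\<close>.
\<close>

lemma conn_field:
  assumes "smooth_on UNIV f" "smooth_on UNIV g"
  shows "conn (phi k) v (tangent_field k f g) =
    tangent_field k (\<lambda>p. dir_deriv v f p + speed k * fst v * g p) (\<lambda>p. dir_deriv v g p - speed k * fst v * f p)"
proof
  fix p
  have "tangent_field k f g = (\<lambda>p. f p *\<^sub>R frame_e k p + g p *\<^sub>R frame_n k p)"
    by (rule ext) (simp add: tangent_field_def in_frame_def)
  then have "dir_deriv v (tangent_field k f g) p =
      in_frame k p (dir_deriv v f p + speed k * fst v * g p) (dir_deriv v g p - speed k * fst v * f p)
      - (speed k * fst v * f p) *\<^sub>R phi k p"
    by (simp add: dir_deriv_rules smooth_intros smooth_frame assms dir_deriv_frame_e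
        dir_deriv_frame_n in_frame_def algebra_simps)
  then show "conn (phi k) v (tangent_field k f g) p = tangent_field k (\<lambda>p. dir_deriv v f p + speed k * fst v * g p)
      (\<lambda>p. dir_deriv v g p - speed k * fst v * f p) p"
    by (simp add: conn_def tangent_field_def inner_diff_left in_frame_inner_phi inner_frame)
qed

text \<open>
  The rough Laplacian of \<open>f e + g n\<close> has the components \<open>lap_e\<close> and \<open>lap_n\<close>; the scalar Laplacian
  \<open>lap\<close> has the same sign, so it is nonnegative on plane waves.
\<close>

definition lap :: "(pt \<Rightarrow> real) \<Rightarrow> pt \<Rightarrow> real" where
  "lap f p = - (D1 (D1 f) p + D2 (D2 f) p)"

definition lap_e :: "nat \<Rightarrow> (pt \<Rightarrow> real) \<Rightarrow> (pt \<Rightarrow> real) \<Rightarrow> pt \<Rightarrow> real" where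
  "lap_e k f g p = lap f p + (speed k)\<^sup>2 * f p - 2 * speed k * D1 g p"

definition lap_n :: "nat \<Rightarrow> (pt \<Rightarrow> real) \<Rightarrow> (pt \<Rightarrow> real) \<Rightarrow> pt \<Rightarrow> real" where
  "lap_n k f g p = lap g p + (speed k)\<^sup>2 * g p + 2 * speed k * D1 f p"

lemma smooth_lap: "smooth_on UNIV f \<Longrightarrow> smooth_on UNIV (lap f)"
  unfolding lap_def by (intro smooth_intros)

lemma smooth_lap_e: "smooth_on UNIV f \<Longrightarrow> smooth_on UNIV g \<Longrightarrow> smooth_on UNIV (lap_e k f g)"
  unfolding lap_e_def by (intro smooth_intros smooth_lap)

lemma smooth_lap_n: "smooth_on UNIV f \<Longrightarrow> smooth_on UNIV g \<Longrightarrow> smooth_on UNIV (lap_n k f g)"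
  unfolding lap_n_def by (intro smooth_intros smooth_lap)

lemma rough_laplacian_field:
  assumes "smooth_on UNIV f" "smooth_on UNIV g"
  shows "rough_laplacian (phi k) (tangent_field k f g) = tangent_field k (lap_e k f g) (lap_n k f g)"
  unfolding rough_laplacian_def sum_Basis_pt
  by (simp add: conn_field dir_deriv_rules smooth_intros assms)
     (rule ext, simp add: tangent_field_def in_frame_algebra in_frame_eq_iff lap_e_def lap_n_def lap_def
       algebra_simps power2_eq_square)

lemma tension_phi: "tension (phi k) = tangent_field k (\<lambda>p. 0) (\<lambda>p. - (speed k)\<^sup>2)"
proof -
  have "dir_deriv v (phi k) = tangent_field k (\<lambda>p. speed k * fst v) (\<lambda>p. 0)" for v
    by (rule ext) (simp add: dir_deriv_phi tangent_field_def in_frame_def)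
  then show ?thesis
    by (intro ext) (simp add: tension_def sum_Basis_pt conn_field smooth_const, simp add: tangent_field_def in_frame_def power2_eq_square)
qed

lemma dir_deriv_phi_in_frame: "dir_deriv v (phi k) p = in_frame k p (speed k * fst v) 0"
  by (simp add: dir_deriv_phi in_frame_def)

lemma norm_d_sq_phi: "norm_d_sq (phi k) p = (speed k)\<^sup>2"
  by (simp add: norm_d_sq_def sum_Basis_pt dir_deriv_phi_in_frame power2_norm_eq_inner in_frame_inner)
     (simp add: power2_eq_square)

lemma T_op_field: "T_op (phi k) (tangent_field k f g) = tangent_field k (\<lambda>p. (speed k)\<^sup>2 * f p) (\<lambda>p. 0)"
  by (rule ext) (simp add: T_op_def sum_Basis_pt dir_deriv_phi_in_frame tangent_field_def in_frame_inner
      in_frame_algebra, simp add: power2_eq_square algebra_simps)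

text \<open>
  The components of \<open>I\<^sub>2\<close>.  The inner rough Laplacian is kept as a block, so that the orders in which
  \<open>\<partial>\<^sub>\<gamma>\<close> and the Laplacian are applied are those of the definition of \<open>I\<^sub>2\<close>.
\<close>

definition I2_e :: "nat \<Rightarrow> (pt \<Rightarrow> real) \<Rightarrow> (pt \<Rightarrow> real) \<Rightarrow> pt \<Rightarrow> real" where
  "I2_e k f g p = lap (lap_e k f g) p + (speed k)\<^sup>2 * lap_e k f g p - 2 * speed k * D1 (lap_n k f g) p
     + 4 * speed k ^ 3 * D1 g p - speed k ^ 4 * f p"

definition I2_n :: "nat \<Rightarrow> (pt \<Rightarrow> real) \<Rightarrow> (pt \<Rightarrow> real) \<Rightarrow> pt \<Rightarrow> real" where
  "I2_n k f g p = lap (lap_n k f g) p + 2 * speed k * D1 (lap_e k f g) p - (speed k)\<^sup>2 * lap g p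
     - 4 * speed k ^ 4 * g p - 2 * speed k ^ 3 * D1 f p"

lemma I2_field:
  assumes "smooth_on UNIV f" "smooth_on UNIV g"
  shows "I2 (phi k) (tangent_field k f g) = tangent_field k (I2_e k f g) (I2_n k f g)"
proof
  fix p
  have 1: "(\<lambda>q. T_op (phi k) (tangent_field k f g) q - norm_d_sq (phi k) q *\<^sub>R tangent_field k f g q) =
      tangent_field k (\<lambda>q. 0) (\<lambda>q. - (speed k)\<^sup>2 * g q)"
    by (rule ext) (simp add: T_op_field norm_d_sq_phi, simp add: tangent_field_def in_frame_algebra)
  have lap0: "lap (\<lambda>p. 0) = (\<lambda>p. 0)" by (rule ext) (simp add: lap_def)
  have lapc: "lap (\<lambda>q. c * g q) = (\<lambda>q. c * lap g q)" for c
    by (rule ext) (simp add: lap_def dir_deriv_cmult assms smooth_intros algebra_simps)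
  have 2: "lap_e k (\<lambda>q. 0) (\<lambda>q. - (speed k)\<^sup>2 * g q) p = 2 * speed k ^ 3 * D1 g p"
    unfolding lap_e_def by (simp only: lap0 dir_deriv_cmult assms) (simp add: eval_nat_numeral)
  have 3: "lap_n k (\<lambda>q. 0) (\<lambda>q. - (speed k)\<^sup>2 * g q) p = - (speed k)\<^sup>2 * lap g p - speed k ^ 4 * g p"
    unfolding lap_n_def by (simp only: lapc) (simp add: eval_nat_numeral)
  show "I2 (phi k) (tangent_field k f g) p = tangent_field k (I2_e k f g) (I2_n k f g) p"
    unfolding I2_def sum_Basis_pt d_inner_def 1
    \<comment> \<open>All thirteen terms become frame vectors, and comparing components leaves two identities that
      are linear in the derivatives of \<open>f\<close> and \<open>g\<close>.\<close>
    apply (simp only: rough_laplacian_field tension_phi conn_field T_op_field norm_d_sq_phi assms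
        smooth_intros smooth_lap_e smooth_lap_n dir_deriv_phi_in_frame power2_norm_eq_inner)
    apply (simp only: tangent_field_def in_frame_algebra in_frame_inner in_frame_eq_iff 2 3)
    apply (simp only: I2_e_def I2_n_def lap_e_def[of k f g p] lap_n_def[of k f g p]
      lap_e_def[of k "lap_e k f g"] lap_n_def[of k "lap_e k f g"] fst_conv snd_conv
      mult_1_right mult_zero_right mult_zero_left add_0_left add_0_right diff_zero diff_0 dir_deriv_const)
    apply (simp add: eval_nat_numeral)
    apply (simp add: algebra_simps)
    done
qed

section \<open>Biharmonicity\<close>

text \<open>
  The tension field is the tangential part of the flat Laplacian, so its length follows from
  Pythagoras.
\<close>

lemma norm_tension_sq:
  assumes "\<phi> p \<bullet> \<phi> p = 1"
  defines "L \<equiv> D1 (D1 \<phi>) p + D2 (D2 \<phi>) p"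
  shows "(norm (tension \<phi> p))\<^sup>2 = L \<bullet> L - (L \<bullet> \<phi> p)\<^sup>2"
proof -
  have "tension \<phi> p = L - (L \<bullet> \<phi> p) *\<^sub>R \<phi> p"
    by (simp add: tension_def sum_Basis_pt conn_def L_def inner_add_left algebra_simps)
  then show ?thesis
    using assms(1) by (simp add: power2_norm_eq_inner inner_diff_left inner_diff_right inner_commute)
      (simp add: power2_eq_square)
qed

lemma
  fixes \<Psi> :: "real \<times> pt \<Rightarrow> 'a::real_normed_vector"
  assumes "\<Psi> differentiable (at (t, p))"
  shows dir_deriv_slice: "dir_deriv v (\<lambda>q. \<Psi> (t, q)) p = dir_deriv (0, v) \<Psi> (t, p)"
    and time_derivative_slice: "((\<lambda>s. \<Psi> (s, p)) has_vector_derivative dir_deriv (1, 0) \<Psi> (t, p)) (at t)"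
proof -
  have "((\<lambda>q. (t, q)) has_derivative (\<lambda>h. (0, h))) (at p)"
    by (auto intro!: derivative_eq_intros)
  from has_derivative_compose[OF this has_derivative_dir_deriv[OF assms]]
  show "dir_deriv v (\<lambda>q. \<Psi> (t, q)) p = dir_deriv (0, v) \<Psi> (t, p)" by (rule dir_deriv_eq)
  have "((\<lambda>s. (s, p)) has_vector_derivative (1, 0)) (at t)"
    by (auto simp: has_vector_derivative_def intro!: derivative_eq_intros)
  from has_vector_derivative_along_curve[OF this assms]
  show "((\<lambda>s. \<Psi> (s, p)) has_vector_derivative dir_deriv (1, 0) \<Psi> (t, p)) (at t)" .
qed

text \<open>
  Differentiation under the integral sign, at the centre of an open time interval.
\<close>

lemma torus_integral_has_derivative:
  fixes F F' :: "real \<times> pt \<Rightarrow> real"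
  assumes "\<epsilon> > 0"
    and "\<And>t p. t \<in> {-\<epsilon><..<\<epsilon>} \<Longrightarrow> ((\<lambda>t. F (t, p)) has_vector_derivative F' (t, p)) (at t)"
    and "continuous_on ({-\<epsilon><..<\<epsilon>} \<times> UNIV) F" "continuous_on ({-\<epsilon><..<\<epsilon>} \<times> UNIV) F'"
  shows "((\<lambda>t. torus_integral (\<lambda>p. F (t, p))) has_vector_derivative torus_integral (\<lambda>p. F' (0, p))) (at 0)"
proof -
  have "((\<lambda>t. torus_integral (\<lambda>p. F (t, p))) has_vector_derivative torus_integral (\<lambda>p. F' (0, p)))
      (at 0 within {-\<epsilon><..<\<epsilon>})"
  proof (rule leibniz_rule_vector_derivative)
    show "((\<lambda>t. F (t, p)) has_vector_derivative F' (t, p)) (at t within {-\<epsilon><..<\<epsilon>})"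
      if "t \<in> {-\<epsilon><..<\<epsilon>}" for t p
      using assms(2)[OF that] by (rule has_vector_derivative_at_within)
    show "(\<lambda>p. F (t, p)) integrable_on cbox (0, 0) (2 * pi, 2 * pi)" if "t \<in> {-\<epsilon><..<\<epsilon>}" for t
      by (rule integrable_continuous, rule continuous_on_compose2[OF assms(3)])
        (use that in \<open>auto intro!: continuous_intros\<close>)
    show "continuous_on ({-\<epsilon><..<\<epsilon>} \<times> cbox (0, 0) (2 * pi, 2 * pi)) (\<lambda>(t, p). F' (t, p))"
      using continuous_on_subset[OF assms(4), of "{-\<epsilon><..<\<epsilon>} \<times> cbox (0, 0) (2 * pi, 2 * pi)"]
      by (simp add: Sigma_mono)
  qed (use assms(1) in auto)
  moreover have "at 0 within {-\<epsilon><..<\<epsilon>} = at (0 :: real)"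
    by (rule at_within_open) (use assms(1) in auto)
  ultimately show ?thesis by (simp only:)
qed

lemma dir_deriv_dir_deriv_frame:
  "dir_deriv v (\<lambda>p. a *\<^sub>R frame_e k p) = (\<lambda>p. - (a * (speed k * fst v)) *\<^sub>R (phi k p + frame_n k p))"
  by (subst dir_deriv_scaleR[OF smooth_const smooth_frame(1)])
    (simp only: dir_deriv_frame_e dir_deriv_const scaleR_zero_left add_0_right scaleR_scaleR mult_minus_right)

lemma laplacian_phi: "D1 (D1 (phi k)) p + D2 (D2 (phi k)) p = - (speed k)\<^sup>2 *\<^sub>R (phi k p + frame_n k p)"
  by (simp only: dir_deriv_phi dir_deriv_dir_deriv_frame fst_conv mult_1_right mult_zero_right
      minus_zero scaleR_zero_left dir_deriv_const add_0_right power2_eq_square)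

lemma laplacian_frame_n:
  "D1 (D1 (frame_n k)) p + D2 (D2 (frame_n k)) p = - (speed k)\<^sup>2 *\<^sub>R (phi k p + frame_n k p)"
  by (simp only: dir_deriv_frame_n dir_deriv_dir_deriv_frame fst_conv mult_1_right mult_zero_right
      minus_zero scaleR_zero_left dir_deriv_const add_0_right power2_eq_square)

text \<open>
  Two integrations by parts move the Laplacian to the field \<open>n\<close>, where it is known explicitly.
\<close>

lemma integral_laplacian_frame_n:
  assumes u: "smooth_on UNIV u" "torus_periodic u"
  shows "torus_integral (\<lambda>p. (D1 (D1 u) p + D2 (D2 u) p) \<bullet> frame_n k p) =
    torus_integral (\<lambda>p. u p \<bullet> (- (speed k)\<^sup>2 *\<^sub>R (phi k p + frame_n k p)))"
proof -
  note intros = smooth_intros periodic_dir_deriv smooth_frame periodic_frame u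
  have "torus_integral (\<lambda>p. dir_deriv v (dir_deriv v u) p \<bullet> frame_n k p) =
      torus_integral (\<lambda>p. u p \<bullet> dir_deriv v (dir_deriv v (frame_n k)) p)" if v: "v \<in> Basis" for v
    by (simp add: integral_by_parts[OF v] intros)
  from this[of "(1, 0)"] this[of "(0, 1)"]
  have "torus_integral (\<lambda>p. D1 (D1 u) p \<bullet> frame_n k p + D2 (D2 u) p \<bullet> frame_n k p) =
      torus_integral (\<lambda>p. u p \<bullet> D1 (D1 (frame_n k)) p + u p \<bullet> D2 (D2 (frame_n k)) p)"
    by (simp add: Basis_pt integral_add[OF smooth_integrable smooth_integrable] intros)
  then show ?thesis
    unfolding laplacian_frame_n[symmetric] by (simp add: inner_add_left inner_add_right)
qed

lemma sphere_map_phi: "torus_sphere_map (phi k)"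
  unfolding torus_sphere_map_def
proof (intro conjI smooth_frame periodic_frame subsetI)
  fix y assume "y \<in> range (phi k)"
  then obtain p where "y = phi k p" by blast
  then show "y \<in> sphere 0 1" using inner_frame(3)[of k p] by (simp add: norm_eq_1)
qed

text \<open>
  The terms of the first variation that contain \<open>\<langle>\<partial>\<^sub>t L, \<phi>\<rangle>\<close>, with \<open>L\<close> the flat Laplacian of the
  variation, cancel pointwise.  What is left is \<open>2 c\<^sup>2\<close> times the difference of \<open>\<langle>\<partial>\<^sub>t \<Phi>, W\<rangle>\<close> and
  \<open>\<langle>\<partial>\<^sub>t L, n\<rangle>\<close>, where \<open>W\<close> is the common Laplacian of \<open>\<phi>\<close> and \<open>n\<close>; it integrates to zero.
\<close>

lemma biharmonic_phi: "biharmonic (phi k)"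
  unfolding biharmonic_def
proof (intro conjI allI impI sphere_map_phi)
  fix \<epsilon> :: real and \<Phi> :: "real \<Rightarrow> pt \<Rightarrow> real ^ 3"
  assume \<epsilon>: "0 < \<epsilon>" and smooth: "smooth_on ({-\<epsilon><..<\<epsilon>} \<times> UNIV) (\<lambda>(t, p). \<Phi> t p)"
    and sphere: "\<forall>t\<in>{-\<epsilon><..<\<epsilon>}. torus_sphere_map (\<Phi> t)" and \<Phi>0: "\<Phi> 0 = phi k"
  define T where "T = {-\<epsilon><..<\<epsilon>}"
  define \<Psi> where "\<Psi> = (\<lambda>(t, p). \<Phi> t p)"
  define H where "H z = dir_deriv (0, 1, 0) (dir_deriv (0, 1, 0) \<Psi>) z
      + dir_deriv (0, 0, 1) (dir_deriv (0, 0, 1) \<Psi>) z" for z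
  define G where "G z = dir_deriv (1, 0) (dir_deriv (0, 1, 0) (dir_deriv (0, 1, 0) \<Psi>)) z
      + dir_deriv (1, 0) (dir_deriv (0, 0, 1) (dir_deriv (0, 0, 1) \<Psi>)) z" for z
  define V where "V = dir_deriv (1, 0) \<Psi>"
  define c where "c = speed k"
  have \<Psi>: "smooth_on (T \<times> UNIV) \<Psi>" using smooth by (simp add: T_def \<Psi>_def)
  have slice: "\<Phi> t = (\<lambda>p. \<Psi> (t, p))" for t by (simp add: \<Psi>_def)
  have unit: "\<Phi> t p \<bullet> \<Phi> t p = 1" if "t \<in> T" for t p
    using sphere that unfolding torus_sphere_map_def T_def
    by (metis dist_0_norm mem_sphere norm_eq_1 range_subsetD)
  have space2: "dir_deriv v (dir_deriv v (\<Phi> t)) p = dir_deriv (0, v) (dir_deriv (0, v) \<Psi>) (t, p)"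
    if "t \<in> T" for t v p
  proof -
    have "dir_deriv v (\<Phi> t) = (\<lambda>p. dir_deriv (0, v) \<Psi> (t, p))"
      unfolding slice
      by (rule ext) (rule dir_deriv_slice[OF smooth_on_differentiable[OF \<Psi>]], use that in simp)
    then show ?thesis
      using dir_deriv_slice[OF smooth_on_differentiable[OF smooth_on_dir_deriv[OF \<Psi>]], of t p v "(0, v)"] that
      by simp
  qed
  have H: "D1 (D1 (\<Phi> t)) p + D2 (D2 (\<Phi> t)) p = H (t, p)" if "t \<in> T" for t p
    using space2[OF that] by (simp add: H_def)
  have time: "((\<lambda>t. f (t, p)) has_vector_derivative dir_deriv (1, 0) f (t, p)) (at t)"
    if "smooth_on (T \<times> UNIV) f" "t \<in> T" for f :: "real \<times> pt \<Rightarrow> real ^ 3" and t p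
    using time_derivative_slice[OF smooth_on_differentiable[OF that(1)]] that(2) by simp
  have dH: "((\<lambda>t. H (t, p)) has_vector_derivative G (t, p)) (at t)" if "t \<in> T" for t p
    unfolding H_def G_def by (intro has_vector_derivative_add time smooth_on_dir_deriv \<Psi> that)
  have d\<Psi>: "((\<lambda>t. \<Psi> (t, p)) has_vector_derivative V (t, p)) (at t)" if "t \<in> T" for t p
    unfolding V_def by (intro time \<Psi> that)
  have cont: "continuous_on (T \<times> UNIV) \<Psi>" "continuous_on (T \<times> UNIV) H" "continuous_on (T \<times> UNIV) G"
      "continuous_on (T \<times> UNIV) V"
    unfolding H_def[abs_def] G_def[abs_def] V_def
    by (intro continuous_on_add smooth_on_continuous smooth_on_dir_deriv \<Psi>)+
  have inner: "((\<lambda>t. f t \<bullet> g t) has_vector_derivative f t \<bullet> g' + f' \<bullet> g t) (at t)"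
    if "(f has_vector_derivative f') (at t)" "(g has_vector_derivative g') (at t)"
    for f g :: "real \<Rightarrow> real ^ 3" and f' g' t
    using bounded_bilinear.has_vector_derivative[OF bounded_bilinear_inner that] .
  have 0: "0 \<in> T" using \<epsilon> by (simp add: T_def)
  \<comment> \<open>As the variation takes values in the sphere, \<open>U\<close> integrates to twice the bienergy.\<close>
  define U where "U z = H z \<bullet> H z - (H z \<bullet> \<Psi> z) * (H z \<bullet> \<Psi> z)" for z
  define U' where "U' z = 2 * (H z \<bullet> G z) - 2 * (H z \<bullet> \<Psi> z) * (H z \<bullet> V z + G z \<bullet> \<Psi> z)" for z
  have dU: "((\<lambda>t. torus_integral (\<lambda>p. U (t, p))) has_vector_derivative torus_integral (\<lambda>p. U' (0, p))) (at 0)"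
  proof (rule torus_integral_has_derivative[OF \<epsilon>], fold T_def)
    fix t p assume t: "t \<in> T"
    note d = inner[OF dH[OF t] dH[OF t]] inner[OF dH[OF t] d\<Psi>[OF t]]
    show "((\<lambda>t. U (t, p)) has_vector_derivative U' (t, p)) (at t)"
      unfolding U_def
      by (rule has_vector_derivative_eq_rhs,
          rule has_vector_derivative_diff[OF d(1)[of p] has_vector_derivative_mult[OF d(2)[of p] d(2)[of p]]])
        (simp add: U'_def inner_commute algebra_simps)
  qed (unfold U_def[abs_def] U'_def[abs_def], (intro continuous_intros cont)+)
  have U'0: "torus_integral (\<lambda>p. U' (0, p)) = 0"
  proof -
    define W where "W p = - c\<^sup>2 *\<^sub>R (phi k p + frame_n k p)" for p
    have cont_frame: "continuous_on UNIV (frame_n k)" "continuous_on UNIV W"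
      unfolding W_def by (intro continuous_intros smooth_on_continuous smooth_frame)+
    have along: "((\<lambda>t. torus_integral (\<lambda>p. f (t, p) \<bullet> w p)) has_vector_derivative
        torus_integral (\<lambda>p. f' (0, p) \<bullet> w p)) (at 0)"
      if d: "\<And>t p. t \<in> T \<Longrightarrow> ((\<lambda>t. f (t, p)) has_vector_derivative f' (t, p)) (at t)"
        and f: "continuous_on (T \<times> UNIV) f" "continuous_on (T \<times> UNIV) f'"
        and w: "continuous_on UNIV w" for f f' :: "real \<times> pt \<Rightarrow> real ^ 3" and w
    proof -
      define F F' where "F z = f z \<bullet> w (snd z)" and "F' z = f' z \<bullet> w (snd z)" for z
      have cw: "continuous_on (T \<times> UNIV) (\<lambda>z. w (snd z))"
        by (rule continuous_on_compose2[OF w]) (auto intro: continuous_intros)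
      have "((\<lambda>t. torus_integral (\<lambda>p. F (t, p))) has_vector_derivative torus_integral (\<lambda>p. F' (0, p))) (at 0)"
      proof (rule torus_integral_has_derivative[OF \<epsilon>], fold T_def)
        show "((\<lambda>t. F (t, p)) has_vector_derivative F' (t, p)) (at t)" if "t \<in> T" for t p
          using inner[OF d[OF that] has_vector_derivative_const[of "w p"]] by (simp add: F_def F'_def)
      qed (unfold F_def[abs_def] F'_def[abs_def], (intro continuous_on_inner f cw)+)
      then show ?thesis by (simp add: F_def F'_def)
    qed
    \<comment> \<open>Both sides of the integration by parts are functions of time that agree on the whole
      interval, so their time derivatives at \<open>0\<close> agree; \<open>G\<close> is the time derivative of the Laplacian.\<close>
    have "((\<lambda>t. torus_integral (\<lambda>p. H (t, p) \<bullet> frame_n k p)) has_vector_derivative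
        torus_integral (\<lambda>p. G (0, p) \<bullet> frame_n k p)) (at 0)"
      by (rule along[OF dH cont(2,3) cont_frame(1)])
    then have "((\<lambda>t. torus_integral (\<lambda>p. \<Psi> (t, p) \<bullet> W p)) has_vector_derivative
        torus_integral (\<lambda>p. G (0, p) \<bullet> frame_n k p)) (at 0)"
    proof (rule has_vector_derivative_transform_within_open[of _ _ _ T])
      fix t assume t: "t \<in> T"
      then have "smooth_on UNIV (\<Phi> t)" "torus_periodic (\<Phi> t)"
        using sphere by (auto simp: torus_sphere_map_def T_def)
      from integral_laplacian_frame_n[OF this, of k]
      show "torus_integral (\<lambda>p. H (t, p) \<bullet> frame_n k p) = torus_integral (\<lambda>p. \<Psi> (t, p) \<bullet> W p)"
        unfolding H[OF t] W_def c_def by (simp add: slice)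
    qed (use 0 in \<open>auto simp: T_def\<close>)
    moreover have "((\<lambda>t. torus_integral (\<lambda>p. \<Psi> (t, p) \<bullet> W p)) has_vector_derivative
        torus_integral (\<lambda>p. V (0, p) \<bullet> W p)) (at 0)"
      by (rule along[OF d\<Psi> cont(1,4) cont_frame(2)])
    ultimately have eq: "torus_integral (\<lambda>p. G (0, p) \<bullet> frame_n k p) = torus_integral (\<lambda>p. V (0, p) \<bullet> W p)"
      by (rule vector_derivative_unique_at)
    have start: "H (0, p) = W p" "\<Psi> (0, p) = phi k p" for p
      using H[OF 0, of p] laplacian_phi[of k p] by (simp_all add: \<Phi>0 W_def c_def \<Psi>_def)
    have U'_eq: "U' (0, p) = 2 * c\<^sup>2 * (V (0, p) \<bullet> W p - G (0, p) \<bullet> frame_n k p)" for p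
      unfolding U'_def start W_def
      by (simp add: inner_add_left inner_add_right inner_frame inner_commute algebra_simps)
    have "(\<lambda>p. f (0, p) \<bullet> w p) integrable_on cbox (0, 0) (2 * pi, 2 * pi)"
      if "continuous_on (T \<times> UNIV) f" "continuous_on UNIV w" for f :: "real \<times> pt \<Rightarrow> real ^ 3" and w
    proof (intro integrable_continuous continuous_on_inner)
      show "continuous_on (cbox (0, 0) (2 * pi, 2 * pi)) (\<lambda>p. f (0, p))"
        by (rule continuous_on_compose2[OF that(1)]) (use 0 in \<open>auto intro!: continuous_intros\<close>)
    qed (rule continuous_on_subset[OF that(2)], simp)
    from this[OF cont(3) cont_frame(1)] this[OF cont(4) cont_frame(2)]
    have "torus_integral (\<lambda>p. V (0, p) \<bullet> W p - G (0, p) \<bullet> frame_n k p) = 0"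
      by (simp only: integral_diff eq diff_self)
    then show ?thesis unfolding U'_eq integral_mult_right by simp
  qed
  have energy: "bienergy (\<Phi> t) = 1 / 2 * torus_integral (\<lambda>p. U (t, p))" if t: "t \<in> T" for t
    unfolding bienergy_def norm_tension_sq[OF unit[OF t]] H[OF t]
    by (simp add: U_def slice power2_eq_square)
  have "((\<lambda>t. 1 / 2 * torus_integral (\<lambda>p. U (t, p))) has_real_derivative 1 / 2 * 0) (at 0)"
    by (rule DERIV_cmult) (use dU in \<open>simp only: U'0 has_real_derivative_iff_has_vector_derivative\<close>)
  then show "((\<lambda>t. bienergy (\<Phi> t)) has_real_derivative 0) (at 0)"
    unfolding mult_zero_right
    by (rule has_field_derivative_transform_within_open[of _ _ _ T])
      (simp_all only: 0 energy, simp add: T_def)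
qed

lemma proper_biharmonic_phi:
  assumes "k \<ge> 1"
  shows "proper_biharmonic (phi k)"
proof -
  have "tension (phi k) p \<noteq> in_frame k p 0 0" for p
    using speed_pos[OF assms] unfolding tension_phi tangent_field_def in_frame_eq_iff by simp
  then show ?thesis
    unfolding proper_biharmonic_def in_frame_def using biharmonic_phi by auto
qed

section \<open>The action on plane waves\<close>

text \<open>
  The matrix of \<open>I\<^sub>2\<close> on the pairs \<open>(a cos X, b sin X)\<close>: \<open>symbol_e\<close> and \<open>symbol_n\<close> on the diagonal,
  \<open>- symbol_mixed\<close> off it.
\<close>

definition symbol_e :: "nat \<Rightarrow> real \<Rightarrow> real \<Rightarrow> real" where
  "symbol_e k m n = (m\<^sup>2 + n\<^sup>2)\<^sup>2 + 2 * (speed k)\<^sup>2 * (m\<^sup>2 + n\<^sup>2) + 4 * (speed k)\<^sup>2 * m\<^sup>2"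

definition symbol_n :: "nat \<Rightarrow> real \<Rightarrow> real \<Rightarrow> real" where
  "symbol_n k m n = (m\<^sup>2 + n\<^sup>2)\<^sup>2 + 4 * (speed k)\<^sup>2 * m\<^sup>2 - 4 * speed k ^ 4"

definition symbol_mixed :: "nat \<Rightarrow> real \<Rightarrow> real \<Rightarrow> real" where
  "symbol_mixed k m n = 4 * speed k * m * (m\<^sup>2 + n\<^sup>2)"

lemma lap_cos_wave: "lap (\<lambda>p. a * cos_wave m n t p) = (\<lambda>p. (m\<^sup>2 + n\<^sup>2) * a * cos_wave m n t p)"
  by (rule ext) (simp add: lap_def dir_deriv_cmult smooth_intros smooth_wave dir_deriv_uminus
      dir_deriv_cos_wave dir_deriv_sin_wave algebra_simps power2_eq_square)

lemma lap_sin_wave: "lap (\<lambda>p. a * sin_wave m n t p) = (\<lambda>p. (m\<^sup>2 + n\<^sup>2) * a * sin_wave m n t p)"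
  by (rule ext) (simp add: lap_def dir_deriv_cmult smooth_intros smooth_wave dir_deriv_uminus
      dir_deriv_cos_wave dir_deriv_sin_wave algebra_simps power2_eq_square)

lemma D1_cos_wave: "D1 (\<lambda>p. a * cos_wave m n t p) = (\<lambda>p. - (m * a) * sin_wave m n t p)"
  by (simp add: dir_deriv_cmult smooth_wave dir_deriv_cos_wave algebra_simps)

lemma D1_sin_wave: "D1 (\<lambda>p. a * sin_wave m n t p) = (\<lambda>p. (m * a) * cos_wave m n t p)"
  by (simp add: dir_deriv_cmult smooth_wave dir_deriv_sin_wave algebra_simps)

lemma
  fixes a b m n t :: real
  defines "f \<equiv> (\<lambda>p. a * cos_wave m n t p)" and "g \<equiv> (\<lambda>p. b * sin_wave m n t p)"
  shows I2_e_wave: "I2_e k f g p = (symbol_e k m n * a - symbol_mixed k m n * b) * cos_wave m n t p"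
    and I2_n_wave: "I2_n k f g p = (symbol_n k m n * b - symbol_mixed k m n * a) * sin_wave m n t p"
proof -
  define c q where "c = speed k" and "q = m\<^sup>2 + n\<^sup>2"
  have e: "lap_e k f g = (\<lambda>p. ((q + c\<^sup>2) * a - 2 * c * m * b) * cos_wave m n t p)"
    and n: "lap_n k f g = (\<lambda>p. ((q + c\<^sup>2) * b - 2 * c * m * a) * sin_wave m n t p)"
    unfolding f_def g_def lap_e_def lap_n_def lap_cos_wave lap_sin_wave D1_cos_wave D1_sin_wave
    by (auto simp: c_def q_def algebra_simps)
  show "I2_e k f g p = (symbol_e k m n * a - symbol_mixed k m n * b) * cos_wave m n t p"
    "I2_n k f g p = (symbol_n k m n * b - symbol_mixed k m n * a) * sin_wave m n t p"
    unfolding I2_e_def I2_n_def e n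
    unfolding f_def g_def lap_cos_wave lap_sin_wave D1_cos_wave D1_sin_wave
      symbol_e_def symbol_n_def symbol_mixed_def c_def[symmetric] q_def[symmetric]
    by algebra+
qed

text \<open>
  The same matrix acts on the Fourier coefficients of an arbitrary section: each derivative is moved
  to the wave by one integration by parts, which exchanges the cosine coefficient \<open>C\<close> and the sine
  coefficient \<open>S\<close>.
\<close>

lemma
  fixes f g :: "pt \<Rightarrow> real" and m n t :: real
  assumes fg: "smooth_on UNIV f" "torus_periodic f" "smooth_on UNIV g" "torus_periodic g"
    and mn: "m \<in> \<int>" "n \<in> \<int>"
  defines "C \<equiv> (\<lambda>h. torus_integral (\<lambda>p. h p * cos_wave m n t p))"
    and "S \<equiv> (\<lambda>h. torus_integral (\<lambda>p. h p * sin_wave m n t p))"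
  shows I2_e_coefficient: "C (I2_e k f g) = symbol_e k m n * C f - symbol_mixed k m n * S g"
    and I2_n_coefficient: "S (I2_n k f g) = symbol_n k m n * S g - symbol_mixed k m n * C f"
proof -
  note wave = smooth_cos_wave smooth_sin_wave periodic_cos_wave[OF mn] periodic_sin_wave[OF mn]
  have add: "C (\<lambda>p. h p + h' p) = C h + C h'" "S (\<lambda>p. h p + h' p) = S h + S h'"
    if "smooth_on UNIV h" "smooth_on UNIV h'" for h h'
    unfolding C_def S_def distrib_right
    by (intro integral_add smooth_integrable smooth_intros that wave)+
  have diff: "C (\<lambda>p. h p - h' p) = C h - C h'" "S (\<lambda>p. h p - h' p) = S h - S h'"
    if "smooth_on UNIV h" "smooth_on UNIV h'" for h h'
    unfolding C_def S_def left_diff_distrib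
    by (intro integral_diff smooth_integrable smooth_intros that wave)+
  have cm: "C (\<lambda>p. r * h p) = r * C h" "S (\<lambda>p. r * h p) = r * S h" for r h
    unfolding C_def S_def mult.assoc by simp_all
  have D1: "C (D1 h) = m * S h" "S (D1 h) = - m * C h" 
    and D2: "C (D2 h) = n * S h" "S (D2 h) = - n * C h"
    if "smooth_on UNIV h" "torus_periodic h" for h
    unfolding C_def S_def
    using integral_by_parts[OF _ that wave(1,3), of "(1, 0)"] integral_by_parts[OF _ that wave(2,4), of "(1, 0)"]
      integral_by_parts[OF _ that wave(1,3), of "(0, 1)"] integral_by_parts[OF _ that wave(2,4), of "(0, 1)"]
    by (simp_all add: Basis_pt dir_deriv_cos_wave dir_deriv_sin_wave mult.left_commute[of "h _"])
  have lap: "C (lap h) = (m\<^sup>2 + n\<^sup>2) * C h" "S (lap h) = (m\<^sup>2 + n\<^sup>2) * S h"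
    if h: "smooth_on UNIV h" "torus_periodic h" for h
  proof -
    have "lap h = (\<lambda>p. (-1) * (D1 (D1 h) p + D2 (D2 h) p))" by (rule ext) (simp add: lap_def)
    then show "C (lap h) = (m\<^sup>2 + n\<^sup>2) * C h" "S (lap h) = (m\<^sup>2 + n\<^sup>2) * S h"
      by (simp_all only: cm add D1 D2 h smooth_intros periodic_dir_deriv)
        (simp_all add: power2_eq_square algebra_simps)
  qed
  define F G where "F = lap_e k f g" and "G = lap_n k f g"
  have FG: "smooth_on UNIV F" "smooth_on UNIV G" "torus_periodic F" "torus_periodic G"
    unfolding F_def G_def lap_e_def lap_n_def lap_def by (intro smooth_intros periodic_intros fg)+
  note rules = cm add diff D1 D2 lap smooth_lap smooth_intros fg FG
  have CF: "C F = (m\<^sup>2 + n\<^sup>2) * C f + (speed k)\<^sup>2 * C f - 2 * speed k * (m * S g)"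
    unfolding F_def lap_e_def[abs_def] by (simp only: rules)
  have SG: "S G = (m\<^sup>2 + n\<^sup>2) * S g + (speed k)\<^sup>2 * S g + 2 * speed k * (- m * C f)"
    unfolding G_def lap_n_def[abs_def] by (simp only: rules)
  have "C (I2_e k f g) = (m\<^sup>2 + n\<^sup>2) * C F + (speed k)\<^sup>2 * C F - 2 * speed k * (m * S G)
     + 4 * speed k ^ 3 * (m * S g) - speed k ^ 4 * C f"
    unfolding I2_e_def[abs_def] F_def[symmetric] G_def[symmetric] by (simp only: rules)
  then show "C (I2_e k f g) = symbol_e k m n * C f - symbol_mixed k m n * S g"
    unfolding CF SG symbol_e_def symbol_mixed_def by algebra
  have "S (I2_n k f g) = (m\<^sup>2 + n\<^sup>2) * S G + 2 * speed k * (- m * C F) - (speed k)\<^sup>2 * ((m\<^sup>2 + n\<^sup>2) * S g)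
     - 4 * speed k ^ 4 * S g - 2 * speed k ^ 3 * (- m * C f)"
    unfolding I2_n_def[abs_def] F_def[symmetric] G_def[symmetric] by (simp only: rules)
  then show "S (I2_n k f g) = symbol_n k m n * S g - symbol_mixed k m n * C f"
    unfolding CF SG symbol_n_def symbol_mixed_def by algebra
qed

section \<open>Diagonalising the symbol\<close>

text \<open>
  Half the difference of the diagonal entries of the symbol; it is positive for \<open>k \<ge> 1\<close>, which is
  why the coefficient vectors below are never zero.
\<close>

definition half_gap :: "nat \<Rightarrow> real \<Rightarrow> real \<Rightarrow> real" where
  "half_gap k m n = (speed k)\<^sup>2 * (m\<^sup>2 + n\<^sup>2) + 2 * speed k ^ 4"

definition radius :: "nat \<Rightarrow> real \<Rightarrow> real \<Rightarrow> real" where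
  "radius k m n = sqrt ((half_gap k m n)\<^sup>2 + (symbol_mixed k m n)\<^sup>2)"

text \<open>
  The eigenvalues of the symbol.
\<close>

definition branch :: "nat \<Rightarrow> real \<Rightarrow> real \<Rightarrow> bool \<Rightarrow> real" where
  "branch k m n s = (symbol_e k m n + symbol_n k m n) / 2 + pm s * radius k m n"

text \<open>
  The pair \<open>(coef_e, coef_n)\<close> is an eigenvector of the symbol for \<open>branch\<close>, not normalised.  For \<open>m = 0\<close>
  the symbol is diagonal, and the pairs become multiples of \<open>(1, 0)\<close> and \<open>(0, 1)\<close>.
\<close>

definition coef_e :: "nat \<Rightarrow> real \<Rightarrow> real \<Rightarrow> bool \<Rightarrow> real" where
  "coef_e k m n s = (if s then radius k m n + half_gap k m n else symbol_mixed k m n)"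

definition coef_n :: "nat \<Rightarrow> real \<Rightarrow> real \<Rightarrow> bool \<Rightarrow> real" where
  "coef_n k m n s = (if s then - symbol_mixed k m n else radius k m n + half_gap k m n)"

lemma
  shows branch_e: "symbol_e k m n * coef_e k m n s - symbol_mixed k m n * coef_n k m n s
      = branch k m n s * coef_e k m n s"
    and branch_n: "symbol_n k m n * coef_n k m n s - symbol_mixed k m n * coef_e k m n s
      = branch k m n s * coef_n k m n s"
proof -
  have "(radius k m n)\<^sup>2 = (half_gap k m n)\<^sup>2 + (symbol_mixed k m n)\<^sup>2"
    by (simp add: radius_def)
  moreover have "symbol_e k m n = symbol_n k m n + 2 * half_gap k m n"
    by (simp add: symbol_e_def symbol_n_def half_gap_def)
  moreover have "2 * branch k m n s = symbol_e k m n + symbol_n k m n + 2 * (pm s * radius k m n)"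
    by (simp add: branch_def field_simps)
  ultimately have "2 * (symbol_e k m n * coef_e k m n s - symbol_mixed k m n * coef_n k m n s)
      = 2 * (branch k m n s * coef_e k m n s) \<and>
    2 * (symbol_n k m n * coef_n k m n s - symbol_mixed k m n * coef_e k m n s)
      = 2 * (branch k m n s * coef_n k m n s)"
    unfolding coef_e_def coef_n_def pm_def by (cases s; simp; algebra)
  then show "symbol_e k m n * coef_e k m n s - symbol_mixed k m n * coef_n k m n s
      = branch k m n s * coef_e k m n s" "symbol_n k m n * coef_n k m n s - symbol_mixed k m n * coef_e k m n s
      = branch k m n s * coef_n k m n s"
    by simp_all
qed

lemma half_gap_pos: "k \<ge> 1 \<Longrightarrow> half_gap k m n > 0"
  using speed_pos[of k] by (simp add: half_gap_def add_nonneg_pos)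

lemma radius_plus_half_gap_pos: "k \<ge> 1 \<Longrightarrow> radius k m n + half_gap k m n > 0"
  using half_gap_pos[of k m n] by (simp add: radius_def add_nonneg_pos)

lemma speed_powers: "(speed k)\<^sup>2 = (real k)\<^sup>2 / 2" "speed k ^ 4 = real k ^ 4 / 4"
proof -
  show *: "(speed k)\<^sup>2 = (real k)\<^sup>2 / 2" by (simp add: speed_def power_mult_distrib power_divide)
  have "speed k ^ 4 = ((speed k)\<^sup>2)\<^sup>2" by simp
  then show "speed k ^ 4 = real k ^ 4 / 4" unfolding * by (simp add: power_divide)
qed

lemma radius_eq: "radius k m n = 1 / 2 * sqrt (real k ^ 8 + 2 * real k ^ 6 * (m\<^sup>2 + n\<^sup>2)
    + real k ^ 4 * (m\<^sup>2 + n\<^sup>2)\<^sup>2 + 32 * (real k)\<^sup>2 * m\<^sup>2 * (m\<^sup>2 + n\<^sup>2)\<^sup>2)"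
proof -
  have "4 * ((half_gap k m n)\<^sup>2 + (symbol_mixed k m n)\<^sup>2) = real k ^ 8 + 2 * real k ^ 6 * (m\<^sup>2 + n\<^sup>2)
    + real k ^ 4 * (m\<^sup>2 + n\<^sup>2)\<^sup>2 + 32 * (real k)\<^sup>2 * m\<^sup>2 * (m\<^sup>2 + n\<^sup>2)\<^sup>2"
    unfolding half_gap_def symbol_mixed_def power_mult_distrib speed_powers
    by (simp add: field_simps eval_nat_numeral)
  moreover have "radius k m n = 1 / 2 * sqrt (4 * ((half_gap k m n)\<^sup>2 + (symbol_mixed k m n)\<^sup>2))"
    unfolding radius_def real_sqrt_mult by simp
  ultimately show ?thesis by simp
qed

lemma radius_at_0: "radius k 0 n = half_gap k 0 n"
  by (simp add: radius_def symbol_mixed_def half_gap_def)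

text \<open>
  A single formula covers all cases of the list: for \<open>m = 0\<close> the symbol is diagonal and the
  radicand is the square of \<open>half_gap\<close>.
\<close>

lemma entry_eq_branch: "entry k (m, n, s) = branch k m n s"
proof -
  consider "m = 0" "n = 0" | "m > 0" "n = 0" | "m = 0" "n > 0" | "m > 0" "n > 0" by blast
  then show ?thesis
  proof cases
    case 1
    then show ?thesis
      by (simp add: entry_def lambda_00_def branch_def radius_at_0 symbol_e_def symbol_n_def
          half_gap_def speed_powers pm_def)
  next
    case 2
    then show ?thesis
      by (simp add: entry_def lambda_m0_def branch_def radius_eq symbol_e_def symbol_n_def speed_powers)
         (simp add: field_simps eval_nat_numeral)
  next
    case 3
    then show ?thesis
      by (simp add: entry_def lambda_0n_def branch_def radius_at_0 symbol_e_def symbol_n_def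
          half_gap_def speed_powers pm_def)
         (simp add: field_simps eval_nat_numeral)
  next
    case 4
    then show ?thesis
      by (simp add: entry_def lambda_mn_def branch_def radius_eq symbol_e_def symbol_n_def speed_powers)
         (simp add: field_simps eval_nat_numeral)
  qed
qed

section \<open>The family of eigensections\<close>

type_synonym mode = "(nat \<times> nat \<times> bool) \<times> (bool \<times> bool)"

definition signed :: "bool \<Rightarrow> nat \<Rightarrow> real" where
  "signed \<rho> n = (if \<rho> then - real n else real n)"

definition phase :: "bool \<Rightarrow> real" where
  "phase \<sigma> = (if \<sigma> then pi / 2 else 0)"

definition mode_e :: "nat \<Rightarrow> mode \<Rightarrow> pt \<Rightarrow> real" where
  "mode_e k = (\<lambda>((m, n, s), (\<sigma>, \<rho>)) p.
     coef_e k m (signed \<rho> n) s * cos_wave m (signed \<rho> n) (phase \<sigma>) p)"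

definition mode_n :: "nat \<Rightarrow> mode \<Rightarrow> pt \<Rightarrow> real" where
  "mode_n k = (\<lambda>((m, n, s), (\<sigma>, \<rho>)) p.
     coef_n k m (signed \<rho> n) s * sin_wave m (signed \<rho> n) (phase \<sigma>) p)"

definition mode :: "nat \<Rightarrow> mode \<Rightarrow> pt \<Rightarrow> real ^ 3" where
  "mode k i = tangent_field k (mode_e k i) (mode_n k i)"

text \<open>
  The pairs of a phase and a sign that give different modes.  Modes of opposite frequencies
  span the same sections, so only \<open>m \<ge> 0\<close> occurs, and for \<open>m = 0\<close> only one sign of the other
  frequency; for \<open>n = 0\<close> there is no sign to choose.  At frequency
  zero one component of the branch \<open>s\<close> has coefficient zero, and the wave in the other component is
  a constant, which vanishes for one of the two phases: the cosine needs phase \<open>0\<close>, the sine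
  \<open>\<pi> / 2\<close>.
\<close>

definition fibre :: "nat \<times> nat \<times> bool \<Rightarrow> (bool \<times> bool) set" where
  "fibre = (\<lambda>(m, n, s). {(\<sigma>, \<rho>). (m = 0 \<or> n = 0 \<longrightarrow> \<not> \<rho>) \<and> (m = 0 \<and> n = 0 \<longrightarrow> \<sigma> = (\<not> s))})"

definition modes :: "mode set" where
  "modes = {(i, j). j \<in> fibre i}"

lemma card_fibre: "card (fibre i) = entry_mult i"
proof -
  obtain m n s where i: "i = (m, n, s)" by (cases i)
  consider "m = 0" "n = 0" | "m > 0" "n = 0" | "m = 0" "n > 0" | "m > 0" "n > 0" by blast
  then show ?thesis
  proof cases
    case 1
    then have "fibre i = {(\<not> s, False)}" by (auto simp: fibre_def i)
    with 1 show ?thesis by (simp add: i entry_mult_def)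
  next
    case 2
    then have "fibre i = {(True, False), (False, False)}" by (auto simp: fibre_def i)
    with 2 show ?thesis by (simp add: i entry_mult_def)
  next
    case 3
    then have "fibre i = {(True, False), (False, False)}" by (auto simp: fibre_def i)
    with 3 show ?thesis by (simp add: i entry_mult_def)
  next
    case 4
    then have "fibre i = {(True, False), (False, False), (True, True), (False, True)}"
      by (auto simp: fibre_def i)
    with 4 show ?thesis by (simp add: i entry_mult_def)
  qed
qed

lemma signed_Ints: "signed \<rho> n \<in> \<int>"
  by (simp add: signed_def)

lemma smooth_mode: "smooth_on UNIV (mode_e k i)" "smooth_on UNIV (mode_n k i)"
  by (auto simp: mode_e_def mode_n_def split: prod.splits intro!: smooth_intros smooth_wave)

lemma periodic_mode: "torus_periodic (mode_e k i)" "torus_periodic (mode_n k i)"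
  by (auto simp: mode_e_def mode_n_def split: prod.splits
      intro!: periodic_intros periodic_cos_wave periodic_sin_wave signed_Ints)

lemma branch_signed: "branch k m (signed \<rho> n) s = branch k m n s"
  by (simp add: signed_def branch_def symbol_e_def symbol_n_def symbol_mixed_def radius_def half_gap_def)

lemma mode_in_eigenspace: "mode k i \<in> eigenspace (phi k) (entry k (fst i))"
proof -
  obtain m n s \<sigma> \<rho> where i: "i = ((m, n, s), (\<sigma>, \<rho>))" by (metis prod.exhaust)
  have e: "I2_e k (mode_e k i) (mode_n k i) p = entry k (fst i) * mode_e k i p"
    and n: "I2_n k (mode_e k i) (mode_n k i) p = entry k (fst i) * mode_n k i p" for p
    by (simp_all add: i mode_e_def mode_n_def I2_e_wave I2_n_wave branch_e branch_n
        entry_eq_branch branch_signed)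
  show ?thesis
    unfolding eigenspace_def mode_def
    by (auto simp: tangent_field_in_sections smooth_mode periodic_mode I2_field)
       (simp add: tangent_field_def e n in_frame_algebra)
qed

section \<open>Orthogonality\<close>

lemma torus_integral_const: "torus_integral (\<lambda>p. c) = 4 * pi\<^sup>2 * c"
  by (simp add: content_Pair power2_eq_square)

text \<open>
  A wave of nonzero frequency is a derivative of a periodic function.
\<close>

lemma torus_integral_cos_wave:
  assumes "m \<in> \<int>" "n \<in> \<int>"
  shows "torus_integral (cos_wave m n a) = (if m = 0 \<and> n = 0 then 4 * pi\<^sup>2 * cos a else 0)"
proof -
  have "torus_integral (D1 (sin_wave m n a)) = 0" "torus_integral (D2 (sin_wave m n a)) = 0"
    by (intro torus_integral_D1 torus_integral_D2 smooth_wave periodic_sin_wave assms)+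
  then have "m * torus_integral (cos_wave m n a) = 0" "n * torus_integral (cos_wave m n a) = 0"
    by (simp_all add: dir_deriv_sin_wave)
  moreover have "torus_integral (cos_wave 0 0 a) = 4 * pi\<^sup>2 * cos a"
    using torus_integral_const[of "cos a"] by (simp add: cos_wave_def[abs_def])
  ultimately show ?thesis by auto
qed

definition pairing :: "(pt \<Rightarrow> real ^ 3) \<Rightarrow> (pt \<Rightarrow> real ^ 3) \<Rightarrow> real" where
  "pairing V W = torus_integral (\<lambda>p. V p \<bullet> W p)"

lemma pairing_field_waves:
  assumes "smooth_on UNIV f" "smooth_on UNIV g"
  shows "pairing (tangent_field k f g) (tangent_field k (\<lambda>p. a * cos_wave m n t p) (\<lambda>p. b * sin_wave m n t p)) =
    a * torus_integral (\<lambda>p. f p * cos_wave m n t p) + b * torus_integral (\<lambda>p. g p * sin_wave m n t p)"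
proof -
  have "torus_integral (\<lambda>p. a * (f p * cos_wave m n t p) + b * (g p * sin_wave m n t p)) =
     torus_integral (\<lambda>p. a * (f p * cos_wave m n t p)) + torus_integral (\<lambda>p. b * (g p * sin_wave m n t p))"
    by (intro integral_add smooth_integrable smooth_intros smooth_wave assms)
  then show ?thesis
    by (simp add: pairing_def tangent_field_def in_frame_inner algebra_simps)
qed

text \<open>
  By the product formulas a product of two waves is a sum of two waves, one at the difference and
  one at the sum of the frequencies.
\<close>

lemma pairing_waves:
  assumes "m \<in> \<int>" "n \<in> \<int>" "m' \<in> \<int>" "n' \<in> \<int>"
  shows "pairing (tangent_field k (\<lambda>p. a * cos_wave m n t p) (\<lambda>p. b * sin_wave m n t p))
      (tangent_field k (\<lambda>p. a' * cos_wave m' n' t' p) (\<lambda>p. b' * sin_wave m' n' t' p)) =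
    (a * a' + b * b') * (if m = m' \<and> n = n' then 2 * pi\<^sup>2 * cos (t - t') else 0) +
    (a * a' - b * b') * (if m + m' = 0 \<and> n + n' = 0 then 2 * pi\<^sup>2 * cos (t + t') else 0)"
proof -
  have regroup: "a * C * (a' * C') + b * S * (b' * S') = (a * a') * (C * C') + (b * b') * (S * S')" for C C' S S'
    by algebra
  have "a * cos_wave m n t p * (a' * cos_wave m' n' t' p) + b * sin_wave m n t p * (b' * sin_wave m' n' t' p)
     = (a * a' + b * b') / 2 * cos_wave (m - m') (n - n') (t - t') p
     + (a * a' - b * b') / 2 * cos_wave (m + m') (n + n') (t + t') p" for p
    unfolding regroup cos_wave_mult_cos_wave sin_wave_mult_sin_wave by (simp add: field_simps)
  then have "pairing (tangent_field k (\<lambda>p. a * cos_wave m n t p) (\<lambda>p. b * sin_wave m n t p))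
      (tangent_field k (\<lambda>p. a' * cos_wave m' n' t' p) (\<lambda>p. b' * sin_wave m' n' t' p)) =
     torus_integral (\<lambda>p. (a * a' + b * b') / 2 * cos_wave (m - m') (n - n') (t - t') p
     + (a * a' - b * b') / 2 * cos_wave (m + m') (n + n') (t + t') p)"
    by (simp add: pairing_def tangent_field_def in_frame_inner)
  also have "\<dots> = torus_integral (\<lambda>p. (a * a' + b * b') / 2 * cos_wave (m - m') (n - n') (t - t') p)
     + torus_integral (\<lambda>p. (a * a' - b * b') / 2 * cos_wave (m + m') (n + n') (t + t') p)"
    by (intro integral_add smooth_integrable smooth_intros smooth_wave)
  also have "\<dots> = (a * a' + b * b') / 2 * torus_integral (cos_wave (m - m') (n - n') (t - t'))
     + (a * a' - b * b') / 2 * torus_integral (cos_wave (m + m') (n + n') (t + t'))"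
    by (simp only: integral_mult_right)
  finally show ?thesis
    using assms by (simp only: torus_integral_cos_wave Ints_add Ints_diff) (simp add: if_distrib)
qed

lemma pairing_modes:
  "pairing (mode k ((m, n, s), (\<sigma>, \<rho>))) (mode k ((m', n', s'), (\<sigma>', \<rho>'))) =
    (coef_e k m (signed \<rho> n) s * coef_e k m' (signed \<rho>' n') s'
      + coef_n k m (signed \<rho> n) s * coef_n k m' (signed \<rho>' n') s')
    * (if m = m' \<and> signed \<rho> n = signed \<rho>' n' then 2 * pi\<^sup>2 * cos (phase \<sigma> - phase \<sigma>') else 0) +
    (coef_e k m (signed \<rho> n) s * coef_e k m' (signed \<rho>' n') s'
      - coef_n k m (signed \<rho> n) s * coef_n k m' (signed \<rho>' n') s')
    * (if m = 0 \<and> m' = 0 \<and> signed \<rho> n + signed \<rho>' n' = 0 then 2 * pi\<^sup>2 * cos (phase \<sigma> + phase \<sigma>') else 0)"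
  using pairing_waves[of "real m" "signed \<rho> n" "real m'" "signed \<rho>' n'" k "coef_e k m (signed \<rho> n) s"
    "phase \<sigma>" "coef_n k m (signed \<rho> n) s" "coef_e k m' (signed \<rho>' n') s'" "phase \<sigma>'"
    "coef_n k m' (signed \<rho>' n') s'"]
  unfolding mode_def mode_e_def mode_n_def prod.case
  by (simp add: signed_Ints flip: of_nat_add)

lemma cos_phase: "\<sigma> \<noteq> \<sigma>' \<Longrightarrow> cos (phase \<sigma> - phase \<sigma>') = 0" "\<sigma> \<noteq> \<sigma>' \<Longrightarrow> cos (phase \<sigma> + phase \<sigma>') = 0"
  by (auto simp: phase_def)

lemma coef_orthogonal: "s \<noteq> s' \<Longrightarrow> coef_e k m n s * coef_e k m n s' + coef_n k m n s * coef_n k m n s' = 0"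
  by (cases s; cases s') (simp_all add: coef_e_def coef_n_def)

text \<open>
  Different frequencies are orthogonal; since no two frequencies in use are opposite, the sum of two
  of them vanishes only at frequency zero.  At equal frequencies either the phases differ by a right
  angle or the coefficient vectors are orthogonal.
\<close>

lemma pairing_modes_distinct:
  assumes i: "i \<in> modes" and j: "j \<in> modes" and "i \<noteq> j"
  shows "pairing (mode k i) (mode k j) = 0"
proof -
  obtain m n s \<sigma> \<rho> where i_eq: "i = ((m, n, s), (\<sigma>, \<rho>))" by (metis prod.exhaust)
  obtain m' n' s' \<sigma>' \<rho>' where j_eq: "j = ((m', n', s'), (\<sigma>', \<rho>'))" by (metis prod.exhaust)
  have val: "m = 0 \<or> n = 0 \<Longrightarrow> \<not> \<rho>" "m = 0 \<Longrightarrow> n = 0 \<Longrightarrow> \<sigma> = (\<not> s)"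
    "m' = 0 \<or> n' = 0 \<Longrightarrow> \<not> \<rho>'" "m' = 0 \<Longrightarrow> n' = 0 \<Longrightarrow> \<sigma>' = (\<not> s')"
    using i j by (auto simp: i_eq j_eq modes_def fibre_def)
  have same: "n = n' \<and> \<rho> = \<rho>'" if "signed \<rho> n = signed \<rho>' n'"
    using that val(1,3) by (auto simp: signed_def split: if_splits)
  show ?thesis
  proof (cases "m = m' \<and> signed \<rho> n = signed \<rho>' n'")
    case True
    then have eq: "m' = m" "n' = n" "\<rho>' = \<rho>" using same by auto
    show ?thesis
    proof (cases "m = 0 \<and> n = 0")
      case True
      then have "\<sigma> \<noteq> \<sigma>'" using val eq \<open>i \<noteq> j\<close> by (auto simp: i_eq j_eq)
      then show ?thesis unfolding i_eq j_eq pairing_modes by (simp add: cos_phase)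
    next
      case False
      then have "\<not> (m = 0 \<and> m' = 0 \<and> signed \<rho> n + signed \<rho>' n' = 0)"
        using eq by (auto simp: signed_def)
      moreover have "\<sigma> \<noteq> \<sigma>' \<or> s \<noteq> s'" using eq \<open>i \<noteq> j\<close> by (auto simp: i_eq j_eq)
      then have "cos (phase \<sigma> - phase \<sigma>') = 0 \<or> coef_e k m (signed \<rho> n) s * coef_e k m (signed \<rho> n) s'
          + coef_n k m (signed \<rho> n) s * coef_n k m (signed \<rho> n) s' = 0"
        using coef_orthogonal[of s s' k m "signed \<rho> n"] cos_phase(1)[of \<sigma> \<sigma>'] by argo
      ultimately show ?thesis
        unfolding i_eq j_eq pairing_modes eq by (simp only: if_False mult_zero_right mult_eq_0_iff add_0_right) auto
    qed
  next
    case False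
    have "\<not> (m = 0 \<and> m' = 0 \<and> signed \<rho> n + signed \<rho>' n' = 0)"
      using False val by (auto simp: signed_def)
    with False show ?thesis
      unfolding i_eq j_eq pairing_modes by auto
  qed
qed

lemma pairing_mode_self_pos:
  assumes i: "i \<in> modes" and k: "k \<ge> 1"
  shows "pairing (mode k i) (mode k i) > 0"
proof -
  obtain m n s \<sigma> \<rho> where i_eq: "i = ((m, n, s), (\<sigma>, \<rho>))" by (metis prod.exhaust)
  note pos = radius_plus_half_gap_pos[OF k, of m "signed \<rho> n"]
  show ?thesis
  proof (cases "m = 0 \<and> n = 0")
    case True
    then have "\<sigma> = (\<not> s)" "\<rho> = False" using i by (auto simp: i_eq modes_def fibre_def)
    with True pos show ?thesis
      unfolding i_eq pairing_modes
      by (cases s) (auto simp: phase_def coef_e_def coef_n_def symbol_mixed_def signed_def)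
  next
    case False
    then have no: "\<not> (m = 0 \<and> signed \<rho> n + signed \<rho> n = 0)"
      by (auto simp: signed_def)
    have "coef_e k m (signed \<rho> n) s * coef_e k m (signed \<rho> n) s
        + coef_n k m (signed \<rho> n) s * coef_n k m (signed \<rho> n) s > 0"
      using pos by (cases s) (simp_all add: coef_e_def coef_n_def add_pos_nonneg add_nonneg_pos)
    with no show ?thesis
      unfolding i_eq pairing_modes by auto
  qed
qed

text \<open>
  The usual argument for self-adjoint operators, on the level of Fourier coefficients: the pairing
  with a mode is a pairing of coefficient vectors in the plane, where \<open>I\<^sub>2\<close> acts by the symmetric
  symbol on one side and by the eigenvalue of the mode on the other.
\<close>

lemma pairing_eigensection_mode:
  assumes V: "V \<in> eigenspace (phi k) \<mu>" and "entry k (fst i) \<noteq> \<mu>"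
  shows "pairing V (mode k i) = 0"
proof -
  obtain m n s \<sigma> \<rho> where i: "i = ((m, n, s), (\<sigma>, \<rho>))" by (metis prod.exhaust)
  obtain f g where V_eq: "V = tangent_field k f g" and fg: "smooth_on UNIV f" "torus_periodic f"
    "smooth_on UNIV g" "torus_periodic g"
    using V sectionsE unfolding eigenspace_def by blast
  have "tangent_field k (I2_e k f g) (I2_n k f g) p = \<mu> *\<^sub>R tangent_field k f g p" for p
    using V unfolding V_eq eigenspace_def I2_field[OF fg(1,3), symmetric] by blast
  then have I2: "I2_e k f g = (\<lambda>p. \<mu> * f p)" "I2_n k f g = (\<lambda>p. \<mu> * g p)"
    by (intro ext; simp add: tangent_field_def in_frame_algebra in_frame_eq_iff)+
  define N where "N = signed \<rho> n"
  define C where "C = torus_integral (\<lambda>p. f p * cos_wave m N (phase \<sigma>) p)"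
  define S where "S = torus_integral (\<lambda>p. g p * sin_wave m N (phase \<sigma>) p)"
  have ints: "real m \<in> \<int>" "N \<in> \<int>" by (simp_all add: N_def signed_Ints)
  have C: "\<mu> * C = symbol_e k m N * C - symbol_mixed k m N * S"
    using I2_e_coefficient[OF fg ints, of k "phase \<sigma>"] by (simp add: I2 C_def S_def mult.assoc)
  have S: "\<mu> * S = symbol_n k m N * S - symbol_mixed k m N * C"
    using I2_n_coefficient[OF fg ints, of k "phase \<sigma>"] by (simp add: I2 C_def S_def mult.assoc)
  have P: "pairing V (mode k i) = coef_e k m N s * C + coef_n k m N s * S"
    unfolding V_eq mode_def mode_e_def mode_n_def i prod.case N_def[symmetric] C_def S_def
    by (rule pairing_field_waves[OF fg(1,3)])
  have "branch k m N s * pairing V (mode k i) = \<mu> * pairing V (mode k i)"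
    using branch_e[of k m N s] branch_n[of k m N s] C S unfolding P by algebra
  moreover have "branch k m N s \<noteq> \<mu>"
    using assms(2) by (simp add: i entry_eq_branch N_def branch_signed)
  ultimately show ?thesis by simp
qed

section \<open>Completeness of the plane waves\<close>

text \<open>
  Waves with an arbitrary real phase make the class closed under products without case
  distinctions between sines and cosines.
\<close>

inductive trig_poly :: "(pt \<Rightarrow> real) \<Rightarrow> bool" where
  wave: "m \<in> \<int> \<Longrightarrow> n \<in> \<int> \<Longrightarrow> trig_poly (cos_wave m n a)"
| add: "trig_poly f \<Longrightarrow> trig_poly g \<Longrightarrow> trig_poly (\<lambda>p. f p + g p)"
| scale: "trig_poly f \<Longrightarrow> trig_poly (\<lambda>p. c * f p)"

lemma trig_poly_mult:
  assumes "trig_poly f" "trig_poly g"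
  shows "trig_poly (\<lambda>p. f p * g p)"
  using assms(1)
proof induction
  case (wave m n a)
  from assms(2) show ?case
  proof induction
    case (wave m' n' a')
    then show ?case
      unfolding cos_wave_mult_cos_wave using \<open>m \<in> \<int>\<close> \<open>n \<in> \<int>\<close>
      by (intro trig_poly.intros) auto
  next
    case (add f g)
    then show ?case by (simp add: distrib_left trig_poly.add)
  next
    case (scale f c)
    then show ?case by (simp add: mult.left_commute[of _ c] trig_poly.scale)
  qed
next
  case (add f h)
  then show ?case by (simp add: distrib_right trig_poly.add)
next
  case (scale f c)
  then show ?case by (simp add: mult.assoc trig_poly.scale)
qed

text \<open>
  The torus as a compact set in a Euclidean space, where polynomials in the coordinates pull back to
  trigonometric polynomials.
\<close>

definition torus_embed :: "pt \<Rightarrow> complex \<times> complex" where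
  "torus_embed p = (cis (fst p), cis (snd p))"

lemma trig_poly_polynomial:
  assumes "real_polynomial_function h"
  shows "trig_poly (\<lambda>p. h (torus_embed p))"
  using assms
proof induction
  case (linear h)
  then interpret bounded_linear h .
  have "h (torus_embed p) = h (1, 0) * cos_wave 1 0 0 p + h (\<i>, 0) * cos_wave 1 0 (pi / 2) p
      + (h (0, 1) * cos_wave 0 1 0 p + h (0, \<i>) * cos_wave 0 1 (pi / 2) p)" for p
  proof -
    have "torus_embed p = cos (fst p) *\<^sub>R (1, 0) + sin (fst p) *\<^sub>R (\<i>, 0)
        + (cos (snd p) *\<^sub>R (0, 1) + sin (snd p) *\<^sub>R (0, \<i>))"
      by (simp add: torus_embed_def complex_eq_iff)
    then show ?thesis by (simp only: add scaleR) (simp add: cos_wave_def cos_diff)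
  qed
  then show ?case by (simp only:) (intro trig_poly.intros; simp)
next
  case (const c)
  have "trig_poly (\<lambda>p. c * cos_wave 0 0 0 p)" by (intro trig_poly.intros) auto
  then show ?case by (simp add: cos_wave_def)
qed (auto intro: trig_poly.add trig_poly_mult)

lemma periodic_shift:
  assumes "torus_periodic f"
  shows "f (x + 2 * pi * of_int m, y + 2 * pi * of_int n) = f (x, y)"
proof -
  interpret x: periodic_fun_simple "\<lambda>x. f (x, y)" "2 * pi" for y
    by unfold_locales (use assms in \<open>simp add: torus_periodic_def\<close>)
  interpret y: periodic_fun_simple "\<lambda>y. f (x, y)" "2 * pi" for x
    by unfold_locales (use assms in \<open>simp add: torus_periodic_def\<close>)
  show ?thesis using x.plus_of_int y.plus_of_int by (simp add: mult.commute)
qed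

lemma torus_embed_eq_imp:
  assumes "torus_periodic f" "torus_embed p = torus_embed q"
  shows "f p = f q"
proof -
  obtain m n :: int where "fst p = fst q + 2 * pi * m" "snd p = snd q + 2 * pi * n"
    using assms(2) by (auto simp: torus_embed_def complex_eq_iff) (metis sin_cos_eq_iff)
  then show ?thesis
    using periodic_shift[OF assms(1), of "fst q" m "snd q" n] by (metis prod.collapse)
qed

lemma torus_embed_fundamental_domain:
  "\<exists>q \<in> cbox (0, 0) (2 * pi, 2 * pi). torus_embed q = torus_embed p"
proof -
  have *: "\<exists>t. 0 \<le> t \<and> t \<le> 2 * pi \<and> cis t = cis x" for x
  proof -
    define t where "t = frac (x / (2 * pi)) * (2 * pi)"
    have t: "t = x + 2 * pi * of_int (- \<lfloor>x / (2 * pi)\<rfloor>)"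
      by (simp add: t_def frac_def field_simps)
    have "cis t = cis x"
      using iffD2[OF sin_cos_eq_iff, OF exI, OF t] by (simp add: complex_eq_iff)
    moreover have "0 \<le> t" "t \<le> 2 * pi"
      using frac_ge_0[of "x / (2 * pi)"] frac_lt_1[of "x / (2 * pi)"]
      by (auto simp: t_def mult_le_cancel_right2 intro: less_imp_le)
    ultimately show ?thesis by blast
  qed
  from *[of "fst p"] *[of "snd p"] obtain s t where
    "0 \<le> s" "s \<le> 2 * pi" "cis s = cis (fst p)" "0 \<le> t" "t \<le> 2 * pi" "cis t = cis (snd p)"
    by blast
  then show ?thesis by (intro bexI[of _ "(s, t)"]) (auto simp: torus_embed_def)
qed

lemma range_torus_embed: "torus_embed ` cbox (0, 0) (2 * pi, 2 * pi) = range torus_embed"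
proof
  show "range torus_embed \<subseteq> torus_embed ` cbox (0, 0) (2 * pi, 2 * pi)"
    using torus_embed_fundamental_domain by (metis image_eqI image_subsetI)
qed auto

text \<open>
  The embedding restricted to the closed fundamental square is a continuous map from a compact
  space to a Hausdorff space, hence a quotient map, and continuity descends along it.
\<close>

lemma continuous_factor_through_torus_embed:
  fixes f :: "pt \<Rightarrow> real"
  assumes "continuous_on UNIV f" "torus_periodic f"
  obtains F where "continuous_on (range torus_embed) F" "\<And>p. F (torus_embed p) = f p"
proof
  define S where "S = cbox (0, 0) (2 * pi, 2 * pi :: real)"
  define F where "F z = f (SOME p. torus_embed p = z)" for z
  show F: "F (torus_embed p) = f p" for p
    unfolding F_def by (rule torus_embed_eq_imp[OF assms(2)], rule someI) simp
  have image: "torus_embed ` S = range torus_embed"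
    unfolding S_def by (rule range_torus_embed)
  have cont: "continuous_on S torus_embed"
    unfolding torus_embed_def by (intro continuous_intros)
  have "quotient_map (top_of_set S) (top_of_set (range torus_embed)) torus_embed"
    using cont image
    by (intro continuous_imp_quotient_map)
      (auto simp: S_def compact_space_subtopology Hausdorff_space_subtopology)
  moreover have "continuous_map (top_of_set S) euclideanreal (F \<circ> torus_embed)"
    using assms(1) by (auto simp: F comp_def intro: continuous_on_subset)
  ultimately have "continuous_map (top_of_set (range torus_embed)) euclideanreal F"
    by (rule continuous_compose_quotient_map)
  then show "continuous_on (range torus_embed) F" by simp
qed

text \<open>
  If \<open>f\<close> is orthogonal to all waves, then for a trigonometric polynomial \<open>g\<close> within \<open>\<epsilon>\<close> of \<open>f\<close> the
  integral of \<open>f\<^sup>2\<close> is that of \<open>f (f - g)\<close>, which is at most \<open>\<epsilon>\<close> times the integral of \<open>|f|\<close>.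
\<close>

lemma plane_waves_complete:
  fixes f :: "pt \<Rightarrow> real"
  assumes f: "smooth_on UNIV f" "torus_periodic f"
    and orth: "\<And>m n a. m \<in> \<int> \<Longrightarrow> n \<in> \<int> \<Longrightarrow> torus_integral (\<lambda>p. f p * cos_wave m n a p) = 0"
  shows "f p = 0"
proof -
  have smooth: "smooth_on UNIV g" if "trig_poly g" for g
    using that by induction (auto intro: smooth_intros smooth_wave)
  have orth': "torus_integral (\<lambda>p. f p * g p) = 0" if "trig_poly g" for g
    using that
  proof induction
    case (add g h)
    then have "torus_integral (\<lambda>p. f p * g p + f p * h p) = 0"
      by (subst integral_add) (auto intro!: smooth_integrable smooth_intros f intro: smooth)
    then show ?case by (simp add: distrib_left)
  next
    case (scale g c)
    then show ?case by (simp add: mult.left_commute[of _ c])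
  qed (rule orth)
  define I where "I = torus_integral (\<lambda>p. f p * f p)"
  define B where "B = torus_integral (\<lambda>p. \<bar>f p\<bar>)"
  obtain F where F: "continuous_on (range torus_embed) F" "\<And>p. F (torus_embed p) = f p"
    using continuous_factor_through_torus_embed[OF smooth_on_continuous[OF f(1)] f(2)] by blast
  have compact: "compact (range torus_embed)"
    unfolding range_torus_embed[symmetric] torus_embed_def
    by (intro compact_continuous_image compact_cbox continuous_intros)
  have abs: "(\<lambda>p. \<bar>f p\<bar>) integrable_on cbox a b" for a b
    using continuous_on_subset[OF smooth_on_continuous[OF f(1)]]
    by (intro integrable_continuous continuous_intros) auto
  have bound: "I \<le> e * B" if e: "e > 0" for e
  proof -
    obtain h where h: "real_polynomial_function h" "\<And>z. z \<in> range torus_embed \<Longrightarrow> \<bar>F z - h z\<bar> < e"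
      using Stone_Weierstrass_real_polynomial_function[OF compact F(1) e] by blast
    define g where "g p = h (torus_embed p)" for p
    have g: "trig_poly g" unfolding g_def using trig_poly_polynomial[OF h(1)] .
    have close: "\<bar>f p - g p\<bar> \<le> e" for p
      using h(2)[of "torus_embed p"] F(2)[of p] by (simp add: g_def less_imp_le)
    have "I = torus_integral (\<lambda>p. f p * f p) - torus_integral (\<lambda>p. f p * g p)"
      using orth'[OF g] by (simp add: I_def)
    also have "\<dots> = torus_integral (\<lambda>p. f p * (f p - g p))"
      unfolding right_diff_distrib
      by (intro integral_diff[symmetric] smooth_integrable smooth_intros f smooth g)
    also have "\<dots> \<le> torus_integral (\<lambda>p. e * \<bar>f p\<bar>)"
    proof (rule integral_le)
      show "f p * (f p - g p) \<le> e * \<bar>f p\<bar>" for p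
        using mult_left_mono[OF close, of "\<bar>f p\<bar>" p] abs_ge_self[of "f p * (f p - g p)"]
        by (simp add: abs_mult mult.commute)
      show "(\<lambda>p. f p * (f p - g p)) integrable_on cbox (0, 0) (2 * pi, 2 * pi)"
        by (intro smooth_integrable smooth_intros f smooth g)
      show "(\<lambda>p. e * \<bar>f p\<bar>) integrable_on cbox (0, 0) (2 * pi, 2 * pi)"
        using integrable_cmul[OF abs, of e] by simp
    qed
    finally show ?thesis by (simp add: B_def)
  qed
  have "B \<ge> 0" unfolding B_def by (rule integral_nonneg[OF abs]) simp
  have "I \<le> 0"
  proof (rule ccontr)
    assume "\<not> I \<le> 0"
    with \<open>B \<ge> 0\<close> have "I / (B + 1) > 0" "I / (B + 1) * B < I" by (auto simp: field_simps)
    with bound[of "I / (B + 1)"] show False by simp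
  qed
  moreover have "I \<ge> 0"
    unfolding I_def by (rule integral_nonneg) (auto intro!: smooth_integrable smooth_intros f)
  ultimately have "I = 0" by simp
  have zero: "f q = 0" if "q \<in> cbox (0, 0) (2 * pi, 2 * pi)" for q
  proof -
    have ff: "smooth_on UNIV (\<lambda>p. f p * f p)" by (intro smooth_intros f)
    have "f q * f q = 0"
    proof (rule has_integral_0_cbox_imp_0[of "(0, 0)" "(2 * pi, 2 * pi)" "\<lambda>p. f p * f p"])
      show "continuous_on (cbox (0, 0) (2 * pi, 2 * pi)) (\<lambda>p. f p * f p)"
        using smooth_on_continuous[OF ff] continuous_on_subset by blast
      show "((\<lambda>p. f p * f p) has_integral 0) (cbox (0, 0) (2 * pi, 2 * pi))"
        using integrable_integral[OF smooth_integrable[OF ff]] \<open>I = 0\<close> by (metis I_def)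
      show "box (0, 0) (2 * pi, 2 * pi :: real) \<noteq> {}"
        by (auto simp: box_ne_empty Basis_prod_def)
    qed (use that in auto)
    then show ?thesis by simp
  qed
  obtain q where "q \<in> cbox (0, 0) (2 * pi, 2 * pi)" "torus_embed q = torus_embed p"
    using torus_embed_fundamental_domain by blast
  then show ?thesis using zero torus_embed_eq_imp[OF f(2)] by metis
qed

section \<open>Completeness of the modes\<close>

text \<open>
  Orthogonality to the modes decouples into orthogonality of both components to all waves: the
  coefficient vectors of the two branches span the plane, the two phases give sine and cosine, and
  the frequencies not in use are opposite to frequencies in use.
\<close>

lemma modes_complete:
  assumes k: "k \<ge> 1" and V: "V \<in> sections (phi k)"
    and orth: "\<And>i. i \<in> modes \<Longrightarrow> pairing V (mode k i) = 0"
  shows "V p = 0"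
proof -
  obtain f g where V_eq: "V = tangent_field k f g" and fg: "smooth_on UNIV f" "torus_periodic f"
    "smooth_on UNIV g" "torus_periodic g"
    using V sectionsE by blast
  define C where "C m n a = torus_integral (\<lambda>p. f p * cos_wave m n a p)" for m n a
  define S where "S m n a = torus_integral (\<lambda>p. g p * sin_wave m n a p)" for m n a
  have pair: "pairing V (mode k ((m, n, s), (\<sigma>, \<rho>))) =
      coef_e k m (signed \<rho> n) s * C m (signed \<rho> n) (phase \<sigma>)
      + coef_n k m (signed \<rho> n) s * S m (signed \<rho> n) (phase \<sigma>)" for m n s \<sigma> \<rho>
    unfolding V_eq mode_def mode_e_def mode_n_def prod.case C_def S_def
    by (rule pairing_field_waves[OF fg(1,3)])
  note pos = radius_plus_half_gap_pos[OF k]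
  have rotate: "C m n a = cos a * C m n 0 + sin a * C m n (pi / 2)"
    "torus_integral (\<lambda>p. g p * cos_wave m n a p) = sin a * S m n 0 - cos a * S m n (pi / 2)" for m n a
  proof -
    have "f p * cos_wave m n a p = cos a * (f p * cos_wave m n 0 p) + sin a * (f p * cos_wave m n (pi / 2) p)"
      "g p * cos_wave m n a p = sin a * (g p * sin_wave m n 0 p) - cos a * (g p * sin_wave m n (pi / 2) p)" for p
      by (simp_all add: cos_wave_def sin_wave_def cos_diff sin_diff algebra_simps)
    then show "C m n a = cos a * C m n 0 + sin a * C m n (pi / 2)"
      "torus_integral (\<lambda>p. g p * cos_wave m n a p) = sin a * S m n 0 - cos a * S m n (pi / 2)"
      unfolding C_def S_def
      by (simp_all only: integral_mult_right[symmetric])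
        (intro integral_add integral_diff smooth_integrable smooth_intros smooth_wave fg)+
  qed
  \<comment> \<open>At a nonzero frequency both branches occur with the same phase, and the linear system for the
    two coefficients has the determinant \<open>u\<^sup>2 + v\<^sup>2\<close>.\<close>
  have nonzero: "C m (signed \<rho> n) (phase \<sigma>) = 0 \<and> S m (signed \<rho> n) (phase \<sigma>) = 0"
    if "m \<noteq> 0 \<or> n \<noteq> 0" "m = 0 \<or> n = 0 \<longrightarrow> \<not> \<rho>" for m n :: nat and \<sigma> \<rho>
  proof -
    define N u v where "N = signed \<rho> n" and "u = radius k m N + half_gap k m N"
      and "v = symbol_mixed k m N"
    have "((m, n, s), (\<sigma>, \<rho>)) \<in> modes" for s
      using that by (auto simp: modes_def fibre_def)
    from orth[OF this] have "coef_e k m N s * C m N (phase \<sigma>) + coef_n k m N s * S m N (phase \<sigma>) = 0" for s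
      unfolding pair N_def .
    from this[of True] this[of False] have "u * C m N (phase \<sigma>) - v * S m N (phase \<sigma>) = 0"
      "v * C m N (phase \<sigma>) + u * S m N (phase \<sigma>) = 0"
      by (simp_all add: coef_e_def coef_n_def u_def v_def)
    then have "(u * u + v * v) * C m N (phase \<sigma>) = 0" "(u * u + v * v) * S m N (phase \<sigma>) = 0"
      by algebra+
    moreover have "u * u + v * v > 0"
      using pos[of m N] by (simp add: u_def add_pos_nonneg)
    ultimately show ?thesis by (auto simp: N_def)
  qed
  \<comment> \<open>At frequency zero each branch sees only one of the two components.\<close>
  have "((0, 0, s), (\<not> s, False)) \<in> modes" for s
    by (simp add: modes_def fibre_def)
  from orth[OF this] have "coef_e k 0 0 s * C 0 0 (phase (\<not> s)) + coef_n k 0 0 s * S 0 0 (phase (\<not> s)) = 0" for s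
    unfolding pair by (simp add: signed_def)
  from this[of True] this[of False] have zero: "C 0 0 0 = 0" "S 0 0 (pi / 2) = 0"
    using pos[of 0 0] by (simp_all add: coef_e_def coef_n_def symbol_mixed_def phase_def)
  have zero': "C 0 0 (pi / 2) = 0" "S 0 0 0 = 0"
    by (simp_all add: C_def S_def cos_wave_def sin_wave_def)
  have half: "C m n a = 0 \<and> torus_integral (\<lambda>p. g p * cos_wave m n a p) = 0"
    if mn: "m \<in> \<int>" "n \<in> \<int>" and "m > 0 \<or> m = 0 \<and> n \<ge> 0" for m n a
  proof -
    obtain i j where ij: "m = of_int i" "n = of_int j" using mn by (auto elim!: Ints_cases)
    define M K \<rho> where "M = nat i" and "K = nat \<bar>j\<bar>" and "\<rho> = (j < 0)"
    have MK: "m = real M" "n = signed \<rho> K"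
      using that(3) by (auto simp: ij M_def K_def \<rho>_def signed_def)
    have val: "M = 0 \<or> K = 0 \<longrightarrow> \<not> \<rho>"
      using that(3) by (auto simp: ij M_def K_def \<rho>_def)
    have "C m n (phase \<sigma>) = 0 \<and> S m n (phase \<sigma>) = 0" for \<sigma>
    proof (cases "M = 0 \<and> K = 0")
      case True
      then have "m = 0" "n = 0" using MK by (auto simp: signed_def)
      then show ?thesis using zero zero' by (simp add: phase_def)
    next
      case False
      then show ?thesis using nonzero[of M K \<rho> \<sigma>] val unfolding MK by blast
    qed
    from this[of True] this[of False] show ?thesis
      using rotate(1)[of m n a] rotate(2)[of m n a] by (simp add: phase_def)
  qed
  have all: "C m n a = 0 \<and> torus_integral (\<lambda>p. g p * cos_wave m n a p) = 0"
    if mn: "m \<in> \<int>" "n \<in> \<int>" for m n a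
  proof (cases "m > 0 \<or> m = 0 \<and> n \<ge> 0")
    case False
    have "cos_wave m n a p = cos_wave (- m) (- n) (- a) p" for p
      unfolding cos_wave_def using cos_minus[of "m * fst p + n * snd p - a"] by (simp add: algebra_simps)
    moreover have "- m > 0 \<or> - m = 0 \<and> - n \<ge> 0" using False by linarith
    ultimately show ?thesis using half[of "- m" "- n" "- a"] mn by (simp add: C_def)
  qed (use half mn in blast)
  have "f p = 0" by (rule plane_waves_complete[OF fg(1,2)]) (use all in \<open>auto simp: C_def\<close>)
  moreover have "g p = 0" by (rule plane_waves_complete[OF fg(3,4)]) (use all in auto)
  ultimately show ?thesis by (simp add: V_eq tangent_field_def in_frame_def)
qed

section \<open>Eigenspaces\<close>

text \<open>
  With \<open>q = m\<^sup>2 + n\<^sup>2\<close> both branches are at least \<open>(q - 2 c m)\<^sup>2 - 4 c\<^sup>4\<close>: the radius is at most the sum of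
  \<open>half_gap\<close> and \<open>symbol_mixed\<close>, and what remains completes to a square.  So a bound on the entry
  bounds \<open>(m - c)\<^sup>2 + n\<^sup>2\<close>.
\<close>

lemma finite_entry_fibre: "finite {i. entry k i = \<mu>}"
proof -
  define c where "c = speed k"
  define R where "R = \<bar>\<mu> + 4 * c ^ 4\<bar>"
  define T where "T = 1 + R + c\<^sup>2"
  have c: "c \<ge> 0" by (simp add: c_def speed_def)
  have "m \<le> nat \<lceil>1 + T + c\<rceil> \<and> n \<le> nat \<lceil>1 + T + c\<rceil>" if "entry k (m, n, s) = \<mu>" for m n s
  proof -
    define x where "x = (real m)\<^sup>2 + (real n)\<^sup>2 - 2 * c * m"
    have gap: "half_gap k m n \<ge> 0" "symbol_mixed k m n \<ge> 0"
      by (simp_all add: half_gap_def symbol_mixed_def speed_def)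
    have "radius k m n \<le> half_gap k m n + symbol_mixed k m n"
      using real_sqrt_sum_squares_triangle_ineq[of "half_gap k m n" 0 0 "symbol_mixed k m n"] gap
      by (simp add: radius_def)
    moreover have "pm s * radius k m n \<ge> - radius k m n"
      by (simp add: pm_def radius_def)
    moreover have "symbol_e k m n = symbol_n k m n + 2 * half_gap k m n"
      by (simp add: symbol_e_def symbol_n_def half_gap_def)
    ultimately have "branch k m n s \<ge> symbol_n k m n - symbol_mixed k m n"
      unfolding branch_def by argo
    moreover have "symbol_n k m n - symbol_mixed k m n = x\<^sup>2 - 4 * c ^ 4"
      by (simp add: symbol_n_def symbol_mixed_def x_def c_def power2_eq_square algebra_simps)
    ultimately have "x\<^sup>2 \<le> R" using that by (simp add: entry_eq_branch R_def)
    moreover have *: "y \<le> 1 + y\<^sup>2" for y :: real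
    proof -
      have "0 \<le> (y - 1 / 2)\<^sup>2" by simp
      then show ?thesis by (simp add: power2_eq_square algebra_simps)
    qed
    ultimately have "x \<le> 1 + R" by (meson add_left_mono order_trans)
    then have T: "(real m - c)\<^sup>2 + (real n)\<^sup>2 \<le> T"
      by (simp add: T_def x_def power2_eq_square algebra_simps)
    have "real m - c \<le> 1 + T" "real n \<le> 1 + T"
      using *[of "real m - c"] *[of "real n"] T zero_le_power2[of "real m - c"] zero_le_power2[of "real n"]
      by linarith+
    then show ?thesis using c by linarith
  qed
  then have "{i. entry k i = \<mu>} \<subseteq> {..nat \<lceil>1 + T + c\<rceil>} \<times> {..nat \<lceil>1 + T + c\<rceil>} \<times> UNIV"
    by auto
  then show ?thesis by (rule finite_subset) auto
qed

lemma smooth_sum: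
  "(\<And>i. i \<in> I \<Longrightarrow> smooth_on UNIV (f i)) \<Longrightarrow> smooth_on UNIV (\<lambda>p. \<Sum>i\<in>I. f i p)"
  by (induction I rule: infinite_finite_induct) (auto intro: smooth_intros)

lemma pairing_combination:
  assumes V: "V \<in> sections (phi k)" and W: "W \<in> sections (phi k)"
    and U: "\<And>i. i \<in> I \<Longrightarrow> U i \<in> sections (phi k)" and "finite I"
  shows "pairing (\<lambda>p. V p - (\<Sum>i\<in>I. c i *\<^sub>R U i p)) W = pairing V W - (\<Sum>i\<in>I. c i * pairing (U i) W)"
proof -
  have smooth: "smooth_on UNIV (\<lambda>p. X p \<bullet> Y p)"
    if "X \<in> sections (phi k)" "Y \<in> sections (phi k)" for X Y
    using that unfolding sections_def by (auto intro: smooth_intros)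
  have "torus_integral (\<lambda>p. V p \<bullet> W p - (\<Sum>i\<in>I. c i * (U i p \<bullet> W p))) =
      torus_integral (\<lambda>p. V p \<bullet> W p) - torus_integral (\<lambda>p. \<Sum>i\<in>I. c i * (U i p \<bullet> W p))"
    using V W U by (intro integral_diff smooth_integrable smooth_sum smooth_intros smooth) auto
  also have "torus_integral (\<lambda>p. \<Sum>i\<in>I. c i * (U i p \<bullet> W p)) =
      (\<Sum>i\<in>I. torus_integral (\<lambda>p. c i * (U i p \<bullet> W p)))"
    using W U \<open>finite I\<close> by (intro integral_sum smooth_integrable smooth_intros smooth) auto
  finally show ?thesis
    by (simp add: pairing_def inner_diff_left inner_sum_left)
qed

lemma sections_combination:
  assumes "V \<in> sections (phi k)" "\<And>i. i \<in> I \<Longrightarrow> U i \<in> sections (phi k)"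
  shows "(\<lambda>p. V p - (\<Sum>i\<in>I. c i *\<^sub>R U i p)) \<in> sections (phi k)"
proof -
  have "torus_periodic (\<lambda>p. V p - (\<Sum>i\<in>I. c i *\<^sub>R U i p))"
    using assms by (simp add: sections_def torus_periodic_def)
  moreover have "smooth_on UNIV (\<lambda>p. V p - (\<Sum>i\<in>I. c i *\<^sub>R U i p))"
    using assms unfolding sections_def by (auto intro!: smooth_diff smooth_sum smooth_scaleR smooth_const)
  ultimately show ?thesis
    using assms by (auto simp: sections_def inner_diff_left inner_sum_left)
qed

lemma mode_in_sections: "mode k i \<in> sections (phi k)"
  using mode_in_eigenspace[of k i] by (simp add: eigenspace_def)

lemma inj_on_mode: "k \<ge> 1 \<Longrightarrow> inj_on (mode k) modes"
  using pairing_modes_distinct pairing_mode_self_pos by (metis inj_onI less_irrefl)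

text \<open>
  The difference of \<open>V\<close> and its orthogonal projection is orthogonal to the modes in \<open>I\<close> by construction
  and to all other modes because their eigenvalues differ from \<open>\<mu>\<close>.
\<close>

lemma eigensection_expansion:
  assumes k: "k \<ge> 1" and V: "V \<in> eigenspace (phi k) \<mu>"
  defines "I \<equiv> {i \<in> modes. entry k (fst i) = \<mu>}"
  assumes fin: "finite I"
  shows "V = (\<lambda>p. \<Sum>i\<in>I. (pairing V (mode k i) / pairing (mode k i) (mode k i)) *\<^sub>R mode k i p)"
proof
  fix p
  define c where "c i = pairing V (mode k i) / pairing (mode k i) (mode k i)" for i
  define R where "R = (\<lambda>p. V p - (\<Sum>i\<in>I. c i *\<^sub>R mode k i p))"
  have V': "V \<in> sections (phi k)" using V by (simp add: eigenspace_def)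
  have "pairing R (mode k j) = 0" if j: "j \<in> modes" for j
  proof -
    have "pairing R (mode k j) = pairing V (mode k j) - (\<Sum>i\<in>I. c i * pairing (mode k i) (mode k j))"
      unfolding R_def by (rule pairing_combination[OF V' mode_in_sections mode_in_sections fin])
    also have "(\<Sum>i\<in>I. c i * pairing (mode k i) (mode k j)) =
        (\<Sum>i\<in>I. if i = j then pairing V (mode k j) else 0)"
      using pairing_modes_distinct j pairing_mode_self_pos[OF j k]
      by (intro sum.cong) (auto simp: I_def c_def)
    also have "\<dots> = pairing V (mode k j)"
      using fin pairing_eigensection_mode[OF V, of j] j by (auto simp: I_def)
    finally show ?thesis by simp
  qed
  moreover have "R \<in> sections (phi k)"
    unfolding R_def by (rule sections_combination[OF V' mode_in_sections])
  ultimately have "R p = 0" by (intro modes_complete[OF k])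
  then show "V p = (\<Sum>i\<in>I. (pairing V (mode k i) / pairing (mode k i) (mode k i)) *\<^sub>R mode k i p)"
    by (simp add: R_def c_def)
qed

lemma sum_fun_apply: "(\<Sum>i\<in>I. f i) p = (\<Sum>i\<in>I. f i p)"
  for f :: "'i \<Rightarrow> 'p \<Rightarrow> 'a::comm_monoid_add"
  by (induction I rule: infinite_finite_induct) auto

lemma finite_modes_fibre: "finite {i \<in> modes. entry k (fst i) = \<mu>}"
proof (rule finite_subset)
  show "{i \<in> modes. entry k (fst i) = \<mu>} \<subseteq> {i. entry k i = \<mu>} \<times> UNIV" by auto
qed (simp add: finite_entry_fibre)

lemma eigen_multiplicity_eq:
  assumes k: "k \<ge> 1"
  shows "eigen_multiplicity (phi k) \<mu> = (\<Sum>i | entry k i = \<mu>. entry_mult i)"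
proof -
  interpret vs: vector_space "scale_fun :: real \<Rightarrow> (pt \<Rightarrow> real ^ 3) \<Rightarrow> pt \<Rightarrow> real ^ 3"
    by (rule vector_space_scale_fun)
  define I where "I = {i \<in> modes. entry k (fst i) = \<mu>}"
  have fin: "finite I" unfolding I_def by (rule finite_modes_fibre)
  have inj: "inj_on (mode k) I"
    using inj_on_mode[OF k] by (rule inj_on_subset) (auto simp: I_def)
  have "vs.dim (eigenspace (phi k) \<mu>) = card I"
  proof (rule vs.dim_unique)
    show "mode k ` I \<subseteq> eigenspace (phi k) \<mu>"
      using mode_in_eigenspace by (auto simp: I_def)
    show "card (mode k ` I) = card I" by (rule card_image[OF inj])
    show "eigenspace (phi k) \<mu> \<subseteq> vs.span (mode k ` I)"
    proof
      fix V assume V: "V \<in> eigenspace (phi k) \<mu>"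
      have "(\<Sum>i\<in>I. scale_fun (pairing V (mode k i) / pairing (mode k i) (mode k i)) (mode k i))
          \<in> vs.span (mode k ` I)"
        by (intro vs.span_sum vs.span_scale vs.span_base) auto
      also have "(\<Sum>i\<in>I. scale_fun (pairing V (mode k i) / pairing (mode k i) (mode k i)) (mode k i)) = V"
        using eigensection_expansion[OF k V] fin unfolding I_def[symmetric]
        by (intro ext) (simp only: sum_fun_apply, metis)
      finally show "V \<in> vs.span (mode k ` I)" .
    qed
    show "vs.independent (mode k ` I)"
    proof (rule vs.independent_if_scalars_zero)
      show "finite (mode k ` I)" using fin by simp
      fix c W assume zero: "(\<Sum>x\<in>mode k ` I. scale_fun (c x) x) = 0" and "W \<in> mode k ` I"
      then obtain j where j: "j \<in> I" "W = mode k j" by blast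
      have comb: "(\<Sum>i\<in>I. c (mode k i) *\<^sub>R mode k i p) = 0" for p
        using fun_cong[OF zero, of p] by (simp only: sum_fun_apply sum.reindex[OF inj] o_def zero_fun_apply)
      have s0: "(\<lambda>p. 0) \<in> sections (phi k)"
        by (simp add: sections_def smooth_const periodic_const)
      have "pairing (\<lambda>p. 0 - (\<Sum>i\<in>I. c (mode k i) *\<^sub>R mode k i p)) (mode k j) =
          pairing (\<lambda>p. 0) (mode k j) - (\<Sum>i\<in>I. c (mode k i) * pairing (mode k i) (mode k j))"
        by (rule pairing_combination[OF s0 mode_in_sections mode_in_sections fin])
      then have "(\<Sum>i\<in>I. c (mode k i) * pairing (mode k i) (mode k j)) = 0"
        unfolding comb pairing_def by simp
      moreover have "(\<Sum>i\<in>I. c (mode k i) * pairing (mode k i) (mode k j)) =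
          (\<Sum>i\<in>I. if i = j then c W * pairing W W else 0)"
        using j pairing_modes_distinct by (intro sum.cong) (auto simp: I_def)
      ultimately have "c W * pairing W W = 0" using fin j by simp
      then show "c W = 0"
        using pairing_mode_self_pos[of j k] k j by (simp add: I_def)
    qed
  qed
  also have "I = Sigma {i. entry k i = \<mu>} fibre" by (auto simp: I_def modes_def)
  also have "card \<dots> = (\<Sum>i | entry k i = \<mu>. entry_mult i)"
    using finite_entry_fibre by (subst card_SigmaI) (auto simp: card_fibre)
  finally show ?thesis by (simp add: eigen_multiplicity_def)
qed

lemma fibre_nonempty: "fibre i \<noteq> {}"
  by (cases i) (auto simp: fibre_def)

lemma eigenvalues_eq:
  assumes k: "k \<ge> 1"
  shows "{\<mu>. is_eigenvalue (phi k) \<mu>} = range (entry k)"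
proof (intro set_eqI iffI)
  fix \<mu> assume "\<mu> \<in> range (entry k)"
  then obtain i where i: "\<mu> = entry k i" by blast
  obtain j where "j \<in> fibre i" using fibre_nonempty by blast
  then have mode: "(i, j) \<in> modes" by (simp add: modes_def)
  have "\<exists>p. mode k (i, j) p \<noteq> 0"
  proof (rule ccontr)
    assume "\<nexists>p. mode k (i, j) p \<noteq> 0"
    then have "mode k (i, j) = (\<lambda>p. 0)" by blast
    then have "pairing (mode k (i, j)) (mode k (i, j)) = 0" by (simp add: pairing_def)
    with pairing_mode_self_pos[OF mode k] show False by simp
  qed
  with mode_in_eigenspace[of k "(i, j)"] show "\<mu> \<in> {\<mu>. is_eigenvalue (phi k) \<mu>}"
    by (auto simp: is_eigenvalue_def i)
next
  fix \<mu> assume "\<mu> \<in> {\<mu>. is_eigenvalue (phi k) \<mu>}"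
  then obtain V p where V: "V \<in> eigenspace (phi k) \<mu>" "V p \<noteq> 0"
    by (auto simp: is_eigenvalue_def)
  show "\<mu> \<in> range (entry k)"
  proof (rule ccontr)
    assume "\<mu> \<notin> range (entry k)"
    then have "pairing V (mode k i) = 0" for i
      by (intro pairing_eigensection_mode[OF V(1)]) auto
    moreover have "V \<in> sections (phi k)" using V(1) by (simp add: eigenspace_def)
    ultimately show False using modes_complete[OF k, of V p] V(2) by blast
  qed
qed

section \<open>The spectrum of the second variation operator\<close>

theorem theorem1p3:
  fixes k :: nat
  assumes "k \<ge> 1"
  shows "proper_biharmonic (phi k) \<and>
    {\<mu>. is_eigenvalue (phi k) \<mu>} = range (entry k) \<and>
    (\<forall>\<mu>\<in>range (entry k).
       finite {i. entry k i = \<mu>} \<and>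
       eigen_multiplicity (phi k) \<mu> = (\<Sum>i | entry k i = \<mu>. entry_mult i))"
  using proper_biharmonic_phi[OF assms] eigenvalues_eq[OF assms] finite_entry_fibre
    eigen_multiplicity_eq[OF assms]
  by auto

end
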